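(* Let $\alpha\in(0,1)$, let $A<0$ be a constant, and let $B$ be a function on $[0,T]$ sufficiently regular to ensure existence and uniqueness for the initial value problem ${}_0^CD_t^\alpha x(t)=Ax(t)+B(t)$, $x(0)=x_0$. Let $0=t_0<t_1<\cdots<t_n=T$ be a mesh with $I_j=(t_{j-1},t_j)$, and let $V$ be the space of discontinuous piecewise polynomials of degree at most $k$ on this mesh. Consider the local discontinuous Galerkin scheme: find $X_0,X_1\in V$ such that, for all $v_0,v_1\in V$ and $j=1,\dots,n$, $$ \begin{cases} \bigl(X_0(t_j^-)v_0(t_j^-)-X_0(t_{j-1}^-)v_0(t_{j-1}^+)\bigr)-(X_1,v_0)_{I_j}-\left(X_0,\dfrac{dv_0}{dt}\right)_{I_j}=0,\\[2mm] \left({}_0D_t^{-(1-\alpha)}X_1,v_1\right)_{I_j}=(AX_0+B,v_1)_{I_j},\\[2mm] X_0(t_0^-)=x_0 . \end{cases} $$ Let $\widetilde X_0,\widetilde X_1\in V$ be the approximate (perturbed) solution of $X_0,X_1$, and let $e_{X_i}:=\widetilde X_i-X_i$ ($i=0,1$) be the numerical errors. Then the scheme is $L^\infty$ stable, and the numerical errors satisfy $$ e_{X_0}^2(t_n^-)=e_{X_0}^2(t_0^-)-\sum_{i=1}^n\bigl(\delta e_{X_0}(t_{i-1})\bigr)^2+\frac{2}{A}\cos\left(\frac{(\alpha-1)\pi}{2}\right)\|e_{X_1}\|_{H^{\frac{\alpha-1}{2}}([0,t_n])}^2 , $$ where $\delta e_{X_0}(t_{i-1})=e_{X_0}(t_{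i-1}^+)-e_{X_0}(t_{i-1}^-)$.
   Context: ${}_0^CD_t^\alpha$ is the Caputo derivative, ${}_0^CD_t^\alpha x(t)=\frac{1}{\Gamma(1-\alpha)}\int_0^t(t-\tau)^{-\alpha}x'(\tau)\,d\tau$ for $\alpha\in(0,1)$. The scheme discretizes the equivalent system $x_1=dx_0/dt$, ${}_0D_t^{-(1-\alpha)}x_1=Ax_0+B$, $x_0(0)=x_0$, with upwind fluxes. Notation. $V=\{v:[0,T]\to\mathbb R : v|_{I_j}\in\mathcal P^k(I_j),\ j=1,\dots,n\}$, where $\mathcal P^k(I_j)$ is the set of polynomials of degree at most $k$ on $I_j$. $v(t_j^{\pm})$ is the one-sided limit of $v$ at $t_j$ from the right ($+$) or left ($-$); $X_0(t_0^-)$ denotes the prescribed initial value, and $e_{X_0}(t_0^-)=\widetilde X_0(t_0^-)-X_0(t_0^-)$ is the perturbation of the initial value. $(u,v)_{I_j}=\int_{I_j}uv\,dt$. For $\beta>0$, ${}_0D_t^{-\beta}u(t)=\frac{1}{\Gamma(\beta)}\int_0^t(t-\tau)^{\beta-1}u(\tau)\,d\tau$ is the fractional integral. The errors $e_{X_0},e_{X_1}\in V$ satisfy the error equations obtained from the scheme: for all $v_0,v_1\in V$ and $i=1,\dots,n$, $$\bigl(e_{X_0}(t_i^-)v_0(t_i^-)-e_{X_0}(t_{i-1}^-)v_0(t_{i-1}^+)\bigr)-(e_{X_1},v_0)_{I_i}-\left(e_{X_0},\tfrac{dv_0}{dt}\right)_{I_i}=0,\qquad \left({}_0D_t^{-(1-\alpha)}e_{X_1},v_1\right)_{I_i}=A\,(e_{X_0},v_1)_{I_i}.$$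 The negative-order norm is the one for which $$\bigl({}_0D_t^{\alpha-1}v,v\bigr)_{L^2([0,t_n])}=\cos\left(\frac{(\alpha-1)\pi}{2}\right)\|v\|^2_{H^{\frac{\alpha-1}{2}}([0,t_n])},$$ an identity that determines it, since the cosine is positive for $\alpha\in(0,1)$. The source asserts "$L^\infty$ stable" without giving a formal definition of the term; its proof consists of deriving the displayed error identity, and it remarks that, since $A<0$, the scheme is dissipative. *)

theory Defs
  imports "HOL-Analysis.Analysis"
begin

section \<open>Fractional operators\<close>

definition frac_integral :: "real \<Rightarrow> (real \<Rightarrow> real) \<Rightarrow> real \<Rightarrow> real" where
  "frac_integral \<beta> u s =
     1 / Gamma \<beta> * integral {0..s} (\<lambda>\<tau>. (s - \<tau>) powr (\<beta> - 1) * u \<tau>)"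

definition caputo_deriv :: "real \<Rightarrow> (real \<Rightarrow> real) \<Rightarrow> real \<Rightarrow> real" where
  "caputo_deriv \<alpha> x s =
     1 / Gamma (1 - \<alpha>) * integral {0..s} (\<lambda>\<tau>. (s - \<tau>) powr (-\<alpha>) * deriv x \<tau>)"

text \<open>
  A solution of the initial value problem is an absolutely continuous function on \<open>[0,T]\<close>, that is,
  an indefinite Lebesgue integral, so that its derivative exists almost everywhere and is integrable.
  The equation is required almost everywhere.
\<close>

definition caputo_solution ::
  "real \<Rightarrow> real \<Rightarrow> (real \<Rightarrow> real) \<Rightarrow> real \<Rightarrow> real \<Rightarrow> (real \<Rightarrow> real) \<Rightarrow> bool" where
  "caputo_solution \<alpha> A B T x0 x \<longleftrightarrow>
     (\<exists>g. g absolutely_integrable_on {0..T} \<and> (\<forall>s\<in>{0..T}. x s = x 0 + integral {0..s} g)) \<and>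
     (AE s in lebesgue. s \<in> {0<..<T} \<longrightarrow> caputo_deriv \<alpha> x s = A * x s + B s) \<and>
     x 0 = x0"

text \<open>Solutions are compared on \<open>[0,T]\<close> only, since HOL functions are total.\<close>

definition caputo_ivp_well_posed ::
  "real \<Rightarrow> real \<Rightarrow> (real \<Rightarrow> real) \<Rightarrow> real \<Rightarrow> real \<Rightarrow> bool" where
  "caputo_ivp_well_posed \<alpha> A B T x0 \<longleftrightarrow>
     (\<exists>x. caputo_solution \<alpha> A B T x0 x \<and>
        (\<forall>y. caputo_solution \<alpha> A B T x0 y \<longrightarrow> (\<forall>s\<in>{0..T}. y s = x s)))"

text \<open>
  The norm of \<open>H\<close> with the negative exponent \<open>(\<alpha> - 1)/2\<close> on \<open>[0,b]\<close>: the nonnegative number for which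
  \<open>(D\<^sup>\<alpha>\<^sup>-\<^sup>1 v, v) = cos ((\<alpha> - 1) \<pi> / 2) * norm\<^sup>2\<close> holds on \<open>[0,b]\<close>. The definite description is
  meaningful only because the quadratic form on the left is nonnegative.
\<close>

definition neg_sobolev_norm :: "real \<Rightarrow> real \<Rightarrow> (real \<Rightarrow> real) \<Rightarrow> real" where
  "neg_sobolev_norm \<alpha> b v =
     (THE N. 0 \<le> N \<and>
        integral {0..b} (\<lambda>s. frac_integral (1 - \<alpha>) v s * v s) = cos ((\<alpha> - 1) * pi / 2) * N\<^sup>2)"

section \<open>Mesh and discontinuous piecewise polynomials\<close>

definition mesh :: "real \<Rightarrow> nat \<Rightarrow> (nat \<Rightarrow> real) \<Rightarrow> bool" where
  "mesh T n t \<longleftrightarrow> 1 \<le> n \<and> t 0 = 0 \<and> (\<forall>j<n. t j < t (Suc j)) \<and> t n = T"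

text \<open>The cells are numbered \<open>1, \<dots>, n\<close>.\<close>

definition cell :: "(nat \<Rightarrow> real) \<Rightarrow> nat \<Rightarrow> real set" where
  "cell t j = {t (j - 1)<..<t j}"

text \<open>Values at the mesh points (and outside the mesh) are unconstrained.\<close>

definition dg_space :: "nat \<Rightarrow> (nat \<Rightarrow> real) \<Rightarrow> nat \<Rightarrow> (real \<Rightarrow> real) set" where
  "dg_space n t k =
     {v. \<forall>j\<in>{1..n}. \<exists>p :: real poly. degree p \<le> k \<and> (\<forall>s\<in>cell t j. v s = poly p s)}"

definition rtrace :: "(nat \<Rightarrow> real) \<Rightarrow> (real \<Rightarrow> real) \<Rightarrow> nat \<Rightarrow> real" where
  "rtrace t v j = Lim (at_right (t j)) v"

text \<open>
  The left trace at \<open>t 0\<close> is not a limit: it is the prescribed initial value, passed as \<open>c\<close>.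
\<close>

definition ltrace :: "real \<Rightarrow> (nat \<Rightarrow> real) \<Rightarrow> (real \<Rightarrow> real) \<Rightarrow> nat \<Rightarrow> real" where
  "ltrace c t v j = (if j = 0 then c else Lim (at_left (t j)) v)"

definition trace_jump :: "real \<Rightarrow> (nat \<Rightarrow> real) \<Rightarrow> (real \<Rightarrow> real) \<Rightarrow> nat \<Rightarrow> real" where
  "trace_jump c t v j = rtrace t v j - ltrace c t v j"

definition cell_inner :: "(nat \<Rightarrow> real) \<Rightarrow> nat \<Rightarrow> (real \<Rightarrow> real) \<Rightarrow> (real \<Rightarrow> real) \<Rightarrow> real" where
  "cell_inner t j u v = integral (cell t j) (\<lambda>s. u s * v s)"

section \<open>The local discontinuous Galerkin scheme\<close>

definition ldg_solution ::
  "real \<Rightarrow> real \<Rightarrow> (real \<Rightarrow> real) \<Rightarrow> nat \<Rightarrow> (nat \<Rightarrow> real) \<Rightarrow> nat \<Rightarrow>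
    real \<Rightarrow> (real \<Rightarrow> real) \<Rightarrow> (real \<Rightarrow> real) \<Rightarrow> bool" where
  "ldg_solution \<alpha> A B n t k x0 X0 X1 \<longleftrightarrow>
     X0 \<in> dg_space n t k \<and> X1 \<in> dg_space n t k \<and>
     (\<forall>v0\<in>dg_space n t k. \<forall>v1\<in>dg_space n t k. \<forall>j\<in>{1..n}.
        (ltrace x0 t X0 j * Lim (at_left (t j)) v0 - ltrace x0 t X0 (j - 1) * rtrace t v0 (j - 1))
          - cell_inner t j X1 v0 - cell_inner t j X0 (deriv v0) = 0 \<and>
        cell_inner t j (frac_integral (1 - \<alpha>) X1) v1 = cell_inner t j (\<lambda>s. A * X0 s + B s) v1)"

text \<open>
  Maximum-norm stability of the scheme with respect to perturbations of the initial value: the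
  error in \<open>X0\<close> is bounded on all of \<open>[0,T]\<close> by a constant times the initial perturbation, and the
  constant is one at the mesh points (no amplification from step to step). The constant \<open>C\<close> depends
  on the scheme (in particular on the mesh), but not on the initial values or on the solutions. As
  the error is a polynomial on each open cell, its essential supremum is the supremum over the cells.
\<close>

definition Linf_stable ::
  "real \<Rightarrow> real \<Rightarrow> (real \<Rightarrow> real) \<Rightarrow> nat \<Rightarrow> (nat \<Rightarrow> real) \<Rightarrow> nat \<Rightarrow> bool" where
  "Linf_stable \<alpha> A B n t k \<longleftrightarrow>
     (\<exists>C. \<forall>x0 y0 X0 X1 Y0 Y1.
        ldg_solution \<alpha> A B n t k x0 X0 X1 \<longrightarrow> ldg_solution \<alpha> A B n t k y0 Y0 Y1 \<longrightarrow>
        (\<forall>j\<in>{1..n}. \<bar>ltrace (y0 - x0) t (\<lambda>s. Y0 s - X0 s) j\<bar> \<le> \<bar>y0 - x0\<bar>) \<and>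
        (\<forall>j\<in>{1..n}. \<forall>s\<in>cell t j. \<bar>Y0 s - X0 s\<bar> \<le> C * \<bar>y0 - x0\<bar>))"

end

theory Submission
  imports Defs
begin

text \<open>
  Testing the error equations with the errors themselves turns the first one into a telescoping
  identity for the squares of the left traces, and the second one evaluates its remaining term
  \<open>(e\<^sub>1, e\<^sub>0)\<close> as \<open>1/A\<close> times the fractional quadratic form of \<open>e\<^sub>1\<close>. That form is positive definite:
  \<open>(s - \<tau>) powr (\<beta> - 1)\<close> is a superposition of exponentials \<open>exp (- r (s - \<tau>))\<close> with the positive
  weights \<open>r powr (- \<beta>) / \<Gamma>(1 - \<beta>)\<close>, and the convolution \<open>F\<close> of \<open>w\<close> with a single exponential
  satisfies \<open>F' = w - r F\<close>, so that its pairing with \<open>w\<close> over \<open>[0,b]\<close> is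
  \<open>F(b)\<^sup>2 / 2 + r \<integral> F\<^sup>2\<close>.
\<close>

section \<open>Positivity of the fractional integral form\<close>

text \<open>The energy identity controls only the left traces at the mesh points, so the bound
  inside the cells must come from elsewhere: an error with zero initial perturbation vanishes there,
  hence the error in the first component depends on one real parameter. That uniqueness is where
  definiteness of the form enters; nonnegativity gives the sign of the dissipation and makes the
  norm, a definite description, meaningful. The kernel is singular on the diagonal, so the pairing
  with \<open>w\<close> and the superposition of exponentials are exchanged by Fubini on triples of
  s, \<tau> and r. Absolute integrability is checked by integrating over r first, which returns the
  kernel itself. Definiteness then costs little: the energy of a single exponential already
  determines \<open>w\<close> up to finitely many points.\<close>

lemma has_bochner_integral_lborel_of_has_integral:
  fixes f :: "real \<Rightarrow> real"
  assumes "f \<in> borel_measurable borel" and "\<And>x. 0 \<le> f x" and "(f has_integral c) S"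
    and "S \<in> sets borel"
  shows "has_bochner_integral lborel (\<lambda>x. indicator S x * f x) c"
proof (rule has_bochner_integral_nn_integral)
  show "0 \<le> c"
    using has_integral_nonneg[OF assms(3)] assms(2) by auto
  show "(\<integral>\<^sup>+ x. ennreal (indicator S x * f x) \<partial>lborel) = ennreal c"
    using nn_integral_has_integral_lebesgue[OF assms(2,3)] assms(1,4)
    by (simp add: nn_integral_completion)
qed (use assms in \<open>auto simp: assms(2)\<close>)

text \<open>Euler's integral for \<open>Gamma a\<close> after the substitution of
  \<open>x * r\<close> for the variable. With \<open>a = 1 - \<beta>\<close> and
  \<open>x = s - \<tau>\<close> it is the superposition of exponentials.\<close>

lemma has_bochner_integral_laplace_powr:
  fixes a x :: real
  assumes "0 < a" "0 < x"
  shows "has_bochner_integral lborel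
    (\<lambda>r. indicator {0..} r * (r powr (a - 1) * exp (- (r * x)))) (Gamma a * x powr (- a))"
proof -
  let ?f = "\<lambda>t::real. indicator {0..} t * (t powr (a - 1) / exp t)"
  have "has_bochner_integral lborel ?f (Gamma a)"
    by (rule has_bochner_integral_lborel_of_has_integral)
      (use Gamma_integral_real[OF assms(1)] in auto)
  then have "has_bochner_integral lborel (\<lambda>r. ?f (0 + x * r)) (Gamma a /\<^sub>R \<bar>x\<bar>)"
    by (subst (asm) lborel_has_bochner_integral_real_affine_iff[where c = x and t = 0])
      (use assms in auto)
  then have "has_bochner_integral lborel (\<lambda>r. x powr (1 - a) * ?f (0 + x * r))
      (x powr (1 - a) * (Gamma a /\<^sub>R \<bar>x\<bar>))"
    by (rule has_bochner_integral_mult_right)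
  moreover have "x powr (1 - a) * ?f (0 + x * r)
      = indicator {0..} r * (r powr (a - 1) * exp (- (r * x)))" for r
  proof (cases "0 \<le> r")
    case True
    have "x powr (1 - a) * (x * r) powr (a - 1) = r powr (a - 1)"
      using assms True by (simp add: powr_mult flip: powr_add mult.assoc)
    then show ?thesis
      using True assms by (simp add: exp_minus field_simps)
  next
    case False
    then show ?thesis
      using assms by (simp add: indicator_def zero_le_mult_iff)
  qed
  moreover have "x powr (1 - a) * (Gamma a /\<^sub>R \<bar>x\<bar>) = Gamma a * x powr (- a)"
    using assms by (simp add: powr_diff powr_minus field_simps)
  ultimately show ?thesis
    by (simp only:)
qed

text \<open>Extension by zero turns the integral over the moving interval \<open>{0..s}\<close> into
  one over the whole line with a jointly Borel kernel, the form in which Fubini applies.\<close>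

definition abel_kernel :: "real \<Rightarrow> real \<Rightarrow> real \<Rightarrow> real" where
  "abel_kernel \<beta> s \<tau> = (if 0 \<le> \<tau> \<and> \<tau> < s then (s - \<tau>) powr (\<beta> - 1) else 0)"

lemma abel_kernel_nonneg: "0 \<le> abel_kernel \<beta> s \<tau>"
  by (simp add: abel_kernel_def)

lemma abel_kernel_measurable [measurable]:
  "(\<lambda>p. abel_kernel \<beta> (fst p) (snd p)) \<in> borel_measurable (borel \<Otimes>\<^sub>M borel)"
  unfolding abel_kernel_def by measurable

lemma abel_kernel_measurable_snd [measurable]:
  "abel_kernel \<beta> s \<in> borel_measurable borel"
  unfolding abel_kernel_def by measurable

lemma has_bochner_integral_abel_kernel:
  assumes "0 < \<beta>" "0 \<le> s"
  shows "has_bochner_integral lborel (abel_kernel \<beta> s) (s powr \<beta> / \<beta>)"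
proof -
  have "((\<lambda>\<tau>. (s - \<tau>) powr (\<beta> - 1)) has_integral
      (- ((s - s) powr \<beta>) / \<beta> - (- ((s - 0) powr \<beta>) / \<beta>))) {0..s}"
  \<comment> \<open>For \<beta> < 1 the antiderivative is continuous at the end point
    \<open>s\<close> but not differentiable there.\<close>
  proof (rule fundamental_theorem_of_calculus_interior[OF assms(2)])
    show "continuous_on {0..s} (\<lambda>\<tau>. - ((s - \<tau>) powr \<beta>) / \<beta>)"
      using assms by (intro continuous_intros continuous_on_powr') auto
    show "((\<lambda>\<tau>. - ((s - \<tau>) powr \<beta>) / \<beta>) has_vector_derivative (s - \<tau>) powr (\<beta> - 1)) (at \<tau>)"
      if "\<tau> \<in> {0<..<s}" for \<tau>
      using that assms unfolding has_real_derivative_iff_has_vector_derivative[symmetric]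
      by (auto intro!: derivative_eq_intros)
  qed
  then have "((\<lambda>\<tau>. (s - \<tau>) powr (\<beta> - 1)) has_integral s powr \<beta> / \<beta>) {0..s}"
    using assms by simp
  then have "(abel_kernel \<beta> s has_integral s powr \<beta> / \<beta>) {0..s}"
    by (rule has_integral_spike_finite[of "{s}", rotated -1])  (auto simp: abel_kernel_def)
  then have "has_bochner_integral lborel (\<lambda>\<tau>. indicator {0..s} \<tau> * abel_kernel \<beta> s \<tau>)
      (s powr \<beta> / \<beta>)"
    by (intro has_bochner_integral_lborel_of_has_integral) (auto simp: abel_kernel_nonneg)
  moreover have "(\<lambda>\<tau>. indicator {0..s} \<tau> * abel_kernel \<beta> s \<tau>) = abel_kernel \<beta> s"
    by (auto simp: abel_kernel_def indicator_def)
  ultimately show ?thesis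
    by simp
qed

lemma integrable_abel_kernel:
  assumes "0 < \<beta>"
  shows "integrable lborel (abel_kernel \<beta> s)"
proof (cases "0 \<le> s")
  case True
  then show ?thesis
    using has_bochner_integral_abel_kernel[OF assms] by (auto simp: has_bochner_integral_iff)
next
  case False
  then have "abel_kernel \<beta> s = (\<lambda>_. 0)"
    by (auto simp: abel_kernel_def)
  then show ?thesis by simp
qed

section \<open>The fractional integral of a bounded, piecewise continuous function\<close>

text \<open>\<open>S\<close> will be the set of mesh points. The global bound gives domination, the
  support condition replaces integrals over \<open>{0..b}\<close> by integrals over the line, and
  continuity off \<open>S\<close> gives the differential equation of the exponential convolution at
  all but finitely many points.\<close>

locale piecewise_continuous_on_interval =
  fixes w :: "real \<Rightarrow> real" and b M :: real and S :: "real set"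
  assumes finite_S: "finite S"
    and continuous: "continuous_on (- S) w"
    and bounded: "\<bar>w s\<bar> \<le> M"
    and support: "s \<notin> {0..b} \<Longrightarrow> w s = 0"
    and b_pos: "0 < b"
begin

lemma M_nonneg: "0 \<le> M"
  using bounded[of 0] by linarith

lemma w_measurable [measurable]: "w \<in> borel_measurable borel"
  using borel_measurable_continuous_countable_exceptions[OF countable_finite[OF finite_S] continuous] .

definition abel :: "real \<Rightarrow> real \<Rightarrow> real" where
  "abel \<beta> s = (LINT \<tau>|lborel. abel_kernel \<beta> s \<tau> * w \<tau>)"

lemma abel_measurable [measurable]: "abel \<beta> \<in> borel_measurable borel"
proof -
  have "(\<lambda>s. LINT \<tau>|lborel. (\<lambda>p. abel_kernel \<beta> (fst p) (snd p) * w (snd p)) (s, \<tau>)) \<in> borel_measurable borel"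
    by measurable
  then show ?thesis
    by (simp add: abel_def[abs_def])
qed

lemma abs_abel_kernel_mult_le: "\<bar>abel_kernel \<beta> s \<tau> * w \<tau>\<bar> \<le> M * abel_kernel \<beta> s \<tau>"
  using mult_right_mono[OF bounded[of \<tau>] abel_kernel_nonneg[of \<beta> s \<tau>]] abel_kernel_nonneg[of \<beta> s \<tau>]
  by (simp add: abs_mult mult.commute)

lemma integrable_abel_kernel_mult:
  assumes "0 < \<beta>"
  shows "integrable lborel (\<lambda>\<tau>. abel_kernel \<beta> s \<tau> * w \<tau>)"
proof (rule Bochner_Integration.integrable_bound)
  show "integrable lborel (\<lambda>\<tau>. M * abel_kernel \<beta> s \<tau>)"
    using integrable_abel_kernel[OF assms] by simp
  show "AE \<tau> in lborel. norm (abel_kernel \<beta> s \<tau> * w \<tau>) \<le> norm (M * abel_kernel \<beta> s \<tau>)"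
    by (rule AE_I2) (use order_trans[OF abs_abel_kernel_mult_le abs_ge_self] in \<open>simp only: real_norm_def\<close>)
qed simp

lemma abs_abel_le:
  assumes "0 < \<beta>" "0 \<le> s"
  shows "(LINT \<tau>|lborel. \<bar>abel_kernel \<beta> s \<tau> * w \<tau>\<bar>) \<le> M * (s powr \<beta> / \<beta>)"
    and "\<bar>abel \<beta> s\<bar> \<le> M * (s powr \<beta> / \<beta>)"
proof -
  have "(LINT \<tau>|lborel. \<bar>abel_kernel \<beta> s \<tau> * w \<tau>\<bar>) \<le> (LINT \<tau>|lborel. M * abel_kernel \<beta> s \<tau>)"
    by (intro integral_mono abs_abel_kernel_mult_le integrable_mult_right integrable_abs
      integrable_abel_kernel_mult integrable_abel_kernel assms(1))
  also have "\<dots> = M * (s powr \<beta> / \<beta>)"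
    using has_bochner_integral_abel_kernel[OF assms] by (simp add: has_bochner_integral_iff)
  finally show le: "(LINT \<tau>|lborel. \<bar>abel_kernel \<beta> s \<tau> * w \<tau>\<bar>) \<le> M * (s powr \<beta> / \<beta>)" .
  show "\<bar>abel \<beta> s\<bar> \<le> M * (s powr \<beta> / \<beta>)"
    unfolding abel_def by (rule order_trans[OF integral_abs_bound le])
qed

lemma frac_integral_eq_abel:
  assumes "0 < \<beta>"
  shows "frac_integral \<beta> w s = abel \<beta> s / Gamma \<beta>"
    and "(\<lambda>\<tau>. (s - \<tau>) powr (\<beta> - 1) * w \<tau>) integrable_on {0..s}"
proof -
  \<comment> \<open>At \<tau> = s both sides vanish, because \<open>0 powr x = 0\<close>.\<close>
  have eq: "(\<lambda>\<tau>. abel_kernel \<beta> s \<tau> * w \<tau>)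
      = (\<lambda>\<tau>. indicator {0..s} \<tau> *\<^sub>R ((s - \<tau>) powr (\<beta> - 1) * w \<tau>))"
    by (auto simp: abel_kernel_def indicator_def fun_eq_iff)
  have "set_integrable lborel {0..s} (\<lambda>\<tau>. (s - \<tau>) powr (\<beta> - 1) * w \<tau>)"
    using integrable_abel_kernel_mult[OF assms, of s]
    by (simp add: set_integrable_def eq)
  from set_borel_integral_eq_integral[OF this]
  show "(\<lambda>\<tau>. (s - \<tau>) powr (\<beta> - 1) * w \<tau>) integrable_on {0..s}"
    and "frac_integral \<beta> w s = abel \<beta> s / Gamma \<beta>"
    by (simp_all add: frac_integral_def abel_def set_lebesgue_integral_def eq)
qed

lemma set_integrable_abel_mult:
  assumes "0 < \<beta>" and [measurable]: "g \<in> borel_measurable borel" and g: "\<And>s. \<bar>g s\<bar> \<le> L"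
  shows "set_integrable lborel {0..b} (\<lambda>s. abel \<beta> s * g s)"
proof -
  \<comment> \<open>The kernel is integrable with mass \<open>s powr \<beta> / \<beta>\<close>,
    which is largest at \<open>s = b\<close>; \<open>L\<close> accounts for
    \<open>g\<close>.\<close>
  define C where "C = M * (b powr \<beta> / \<beta>) * L"
  have C: "\<bar>abel \<beta> s * g s\<bar> \<le> C" if "s \<in> {0..b}" for s
  proof -
    have "\<bar>abel \<beta> s\<bar> \<le> M * (s powr \<beta> / \<beta>)"
      using abs_abel_le(2)[OF assms(1)] that by auto
    also have "\<dots> \<le> M * (b powr \<beta> / \<beta>)"
      using that assms(1) M_nonneg
      by (intro mult_left_mono divide_right_mono powr_mono2) auto
    finally show ?thesis
      unfolding C_def abs_mult by (rule mult_mono[OF _ g]) (use M_nonneg assms(1) in auto)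
  qed
  show ?thesis
    unfolding set_integrable_def
  proof (rule Bochner_Integration.integrable_bound)
    show "integrable lborel (\<lambda>s. indicator {0..b} s * C)"
      by (intro integrable_mult_left integrable_real_indicator) (simp_all add: emeasure_lborel_Icc_eq)
    show "AE s in lborel. norm (indicator {0..b} s *\<^sub>R (abel \<beta> s * g s))
        \<le> norm (indicator {0..b} s * C)"
    proof (rule AE_I2)
      fix s
      show "norm (indicator {0..b} s *\<^sub>R (abel \<beta> s * g s)) \<le> norm (indicator {0..b} s * C)"
      proof (cases "s \<in> {0..b}")
        case True
        then show ?thesis
          using order_trans[OF C[OF True] abs_ge_self] by simp
      qed simp
    qed
  qed measurable
qed

text \<open>General Borel subsets allow the use both on a whole interval and on a single open
  cell.\<close>

lemma absolutely_integrable_frac_integral_mult: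
  assumes "0 < \<beta>" and "g \<in> borel_measurable borel" and "\<And>s. \<bar>g s\<bar> \<le> L"
    and A: "A \<subseteq> {0..b}" "A \<in> sets borel"
  shows "(\<lambda>s. frac_integral \<beta> w s * g s) absolutely_integrable_on A"
proof -
  have "set_integrable lborel A (\<lambda>s. abel \<beta> s * g s)"
    using set_integrable_subset[OF set_integrable_abel_mult[OF assms(1-3)]] A by simp
  then have "set_integrable lborel A (\<lambda>s. (abel \<beta> s * g s) / Gamma \<beta>)"
    by (rule set_integrable_divide)
  also have "(\<lambda>s. (abel \<beta> s * g s) / Gamma \<beta>) = (\<lambda>s. frac_integral \<beta> w s * g s)"
    by (simp add: frac_integral_eq_abel(1)[OF assms(1)] fun_eq_iff)
  finally show "(\<lambda>s. frac_integral \<beta> w s * g s) absolutely_integrable_on A"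
    unfolding set_integrable_def
    by (subst integrable_completion) (auto dest: borel_measurable_integrable)
qed

lemma set_integrable_mult_continuous:
  assumes "continuous_on {a..c} g"
  shows "set_integrable lborel {a..c} (\<lambda>\<tau>. g \<tau> * w \<tau>)"
proof -
  have g: "set_integrable lborel {a..c} g"
    unfolding set_integrable_def by (rule borel_integrable_compact[OF compact_Icc assms])
  have eq: "indicator {a..c} \<tau> *\<^sub>R (g \<tau> * w \<tau>) = (indicator {a..c} \<tau> *\<^sub>R g \<tau>) * w \<tau>" for \<tau>
    by simp
  show ?thesis
    unfolding set_integrable_def
  proof (rule Bochner_Integration.integrable_bound)
    show "integrable lborel (\<lambda>\<tau>. (indicator {a..c} \<tau> *\<^sub>R g \<tau>) * M)"
      using g unfolding set_integrable_def by (rule integrable_mult_left)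
    show "(\<lambda>\<tau>. indicator {a..c} \<tau> *\<^sub>R (g \<tau> * w \<tau>)) \<in> borel_measurable lborel"
      unfolding eq using borel_measurable_integrable[OF g[unfolded set_integrable_def]]
      by (intro borel_measurable_times) simp_all
    show "AE \<tau> in lborel. norm (indicator {a..c} \<tau> *\<^sub>R (g \<tau> * w \<tau>))
        \<le> norm ((indicator {a..c} \<tau> *\<^sub>R g \<tau>) * M)"
      unfolding eq norm_mult
      by (rule AE_I2, rule mult_left_mono) (use bounded order_trans[OF bounded abs_ge_self] in auto)
  qed
qed

section \<open>Convolution with one exponential\<close>

text \<open>The function \<open>F\<close> of the overview. With \<open>exp (- (r * s))\<close>
  pulled out, \<open>s\<close> enters the integral only as its upper limit, so the product rule and
  the fundamental theorem give the derivative.\<close>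

definition exp_conv :: "real \<Rightarrow> real \<Rightarrow> real" where
  "exp_conv r s = exp (- (r * s)) * integral {0..s} (\<lambda>\<tau>. exp (r * \<tau>) * w \<tau>)"

lemma exp_mult_w_integrable: "(\<lambda>\<tau>. exp (r * \<tau>) * w \<tau>) integrable_on {a..c}"
  by (intro set_borel_integral_eq_integral(1) set_integrable_mult_continuous continuous_intros)

lemma continuous_on_exp_conv: "continuous_on {0..b} (exp_conv r)"
  unfolding exp_conv_def
  by (intro continuous_intros indefinite_integral_continuous_1 exp_mult_w_integrable)

lemma exp_conv_has_derivative:
  assumes "s \<in> {0<..<b} - S"
  shows "(exp_conv r has_real_derivative w s - r * exp_conv r s) (at s)"
proof -
  have op: "open ({0<..<b} - S)"
    by (simp add: finite_S finite_imp_closed open_Diff)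
  have cont: "continuous (at s) w"
    using continuous assms finite_S
    by (simp add: continuous_on_eq_continuous_at finite_imp_closed open_Compl)
  have "((\<lambda>u. integral {0..u} (\<lambda>\<tau>. exp (r * \<tau>) * w \<tau>)) has_vector_derivative exp (r * s) * w s)
      (at s within {0..b} - S)"
  proof (rule integral_has_vector_derivative_continuous_at[OF exp_mult_w_integrable _ finite_S])
    have "continuous (at s) (\<lambda>\<tau>. exp (r * \<tau>) * w \<tau>)"
      by (intro continuous_intros cont)
    then show "continuous (at s within {0..b} - S) (\<lambda>\<tau>. exp (r * \<tau>) * w \<tau>)"
      by (rule continuous_at_imp_continuous_at_within)
  qed (use assms in auto)
  then have "((\<lambda>u. integral {0..u} (\<lambda>\<tau>. exp (r * \<tau>) * w \<tau>)) has_real_derivative exp (r * s) * w s)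
      (at s)"
    unfolding has_real_derivative_iff_has_vector_derivative
    by (subst (asm) at_within_open_subset[OF assms op]) auto
  from DERIV_mult[OF _ this, of "\<lambda>s. exp (- (r * s))" "- r * exp (- (r * s))"]
  show ?thesis
    unfolding exp_conv_def
    by (rule DERIV_cong) (auto intro!: derivative_eq_intros simp: exp_minus)
qed

lemma exp_conv_mult_w_has_integral:
  "((\<lambda>s. exp_conv r s * w s) has_integral
     (exp_conv r b)\<^sup>2 / 2 + r * integral {0..b} (\<lambda>s. (exp_conv r s)\<^sup>2)) {0..b}"
proof -
  have "((\<lambda>s. exp_conv r s * (w s - r * exp_conv r s)) has_integral
      (exp_conv r b)\<^sup>2 / 2 - (exp_conv r 0)\<^sup>2 / 2) {0..b}"
  \<comment> \<open>The derivative may fail at the jumps of \<open>w\<close>; continuity of the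
    antiderivative bridges these finitely many points.\<close>
  proof (rule fundamental_theorem_of_calculus_interior_strong[OF finite_S])
    show "continuous_on {0..b} (\<lambda>s. (exp_conv r s)\<^sup>2 / 2)"
      by (intro continuous_intros continuous_on_exp_conv) auto
    show "((\<lambda>s. (exp_conv r s)\<^sup>2 / 2) has_vector_derivative
        exp_conv r s * (w s - r * exp_conv r s)) (at s)" if "s \<in> {0<..<b} - S" for s
      unfolding has_real_derivative_iff_has_vector_derivative[symmetric]
      by (rule DERIV_cong, (rule derivative_intros exp_conv_has_derivative[OF that])+) auto
  qed (use b_pos in simp)
  moreover have "((\<lambda>s. r * (exp_conv r s)\<^sup>2) has_integral r * integral {0..b} (\<lambda>s. (exp_conv r s)\<^sup>2)) {0..b}"
    by (intro has_integral_mult_right integrable_integral integrable_continuous_interval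
        continuous_intros continuous_on_exp_conv)
  ultimately have "((\<lambda>s. exp_conv r s * (w s - r * exp_conv r s) + r * (exp_conv r s)\<^sup>2) has_integral
      (exp_conv r b)\<^sup>2 / 2 - (exp_conv r 0)\<^sup>2 / 2 + r * integral {0..b} (\<lambda>s. (exp_conv r s)\<^sup>2)) {0..b}"
    by (rule has_integral_add)
  moreover have "exp_conv r s * (w s - r * exp_conv r s) + r * (exp_conv r s)\<^sup>2 = exp_conv r s * w s" for s
    by (simp add: algebra_simps power2_eq_square)
  \<comment> \<open>The lower boundary term drops out: \<open>exp_conv r 0\<close> is an integral
    over a single point.\<close>
  ultimately show ?thesis
    by (simp add: exp_conv_def)
qed

definition exp_energy :: "real \<Rightarrow> real" where
  "exp_energy r = integral {0..b} (\<lambda>s. exp_conv r s * w s)"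

lemma exp_energy_eq:
  "exp_energy r = (exp_conv r b)\<^sup>2 / 2 + r * integral {0..b} (\<lambda>s. (exp_conv r s)\<^sup>2)"
  unfolding exp_energy_def using exp_conv_mult_w_has_integral by (rule integral_unique)

lemma exp_energy_nonneg: "0 \<le> r \<Longrightarrow> 0 \<le> exp_energy r"
  by (simp add: exp_energy_eq integral_nonneg integrable_continuous_interval
      continuous_on_power continuous_on_exp_conv)

text \<open>Both terms of the energy are nonnegative, so the integral of \<open>F\<^sup>2\<close> is
  zero; continuity gives F = 0 on the interval, and then w = F' + r F = 0 wherever the equation
  holds.\<close>

lemma exp_energy_eq_0_imp:
  assumes "0 < r" "exp_energy r = 0" "s \<in> {0<..<b} - S"
  shows "w s = 0"
proof -
  have nonneg: "0 \<le> integral {0..b} (\<lambda>s. (exp_conv r s)\<^sup>2)"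
    by (intro integral_nonneg integrable_continuous_interval continuous_intros continuous_on_exp_conv) auto
  then have "r * integral {0..b} (\<lambda>s. (exp_conv r s)\<^sup>2) = 0"
    using assms(1,2) mult_nonneg_nonneg[of r "integral {0..b} (\<lambda>s. (exp_conv r s)\<^sup>2)"]
      zero_le_power2[of "exp_conv r b"]
    unfolding exp_energy_eq by linarith
  then have "integral {0..b} (\<lambda>s. (exp_conv r s)\<^sup>2) = 0"
    using assms(1) by simp
  then have "\<forall>s\<in>{0..b}. (exp_conv r s)\<^sup>2 = 0"
    by (subst (asm) integral_eq_0_iff)
      (use b_pos in \<open>auto intro!: continuous_intros continuous_on_exp_conv\<close>)
  then have zero: "exp_conv r u = 0" if "u \<in> {0..b}" for u
    using that by simp
  have "(exp_conv r has_real_derivative 0) (at s)"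
    by (rule has_field_derivative_transform_within_open[of "\<lambda>_. 0" _ _ "{0<..<b}"])
      (use assms zero in auto)
  from DERIV_unique[OF this exp_conv_has_derivative[OF assms(3)]] show ?thesis
    using zero[of s] assms(3) by simp
qed

section \<open>Superposition of the exponentials by Fubini\<close>

text \<open>Integrating over \<open>r\<close> yields the Abel form, integrating over the pair
  \<open>p\<close> yields the exponential energies. The pair is one argument because the exchange is
  between the plane and the line.\<close>

definition laplace_integrand :: "real \<Rightarrow> real \<times> real \<Rightarrow> real \<Rightarrow> real" where
  "laplace_integrand \<beta> p = (\<lambda>r. indicator {0..} r * (r powr (- \<beta>) * exp (- (r * (fst p - snd p)))) *
     (if 0 \<le> snd p \<and> snd p < fst p then w (snd p) * w (fst p) else 0))"

text \<open>The weight in \<open>r\<close> is nonnegative, so absolute values fall on the factors of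
  \<open>w\<close> only and the same Laplace integral settles both claims; the second one supplies
  the domination for Fubini.\<close>

lemma has_bochner_integral_laplace_integrand:
  assumes "0 < \<beta>" "\<beta> < 1"
  shows "has_bochner_integral lborel (laplace_integrand \<beta> (s, \<tau>))
      (Gamma (1 - \<beta>) * (abel_kernel \<beta> s \<tau> * w \<tau> * w s))"
    and "has_bochner_integral lborel (\<lambda>r. \<bar>laplace_integrand \<beta> (s, \<tau>) r\<bar>)
      (Gamma (1 - \<beta>) * (\<bar>abel_kernel \<beta> s \<tau> * w \<tau> * w s\<bar>))"
proof -
  have 1: "has_bochner_integral lborel (\<lambda>r. indicator {0..} r * (r powr (- \<beta>) * exp (- (r * (s - \<tau>)))) * c)
     (Gamma (1 - \<beta>) * (abel_kernel \<beta> s \<tau> * c))" if "0 \<le> \<tau>" "\<tau> < s" for c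
    using has_bochner_integral_mult_left[OF has_bochner_integral_laplace_powr[of "1 - \<beta>" "s - \<tau>"], of c]
      that assms by (simp add: abel_kernel_def mult.assoc)
  show "has_bochner_integral lborel (laplace_integrand \<beta> (s, \<tau>))
      (Gamma (1 - \<beta>) * (abel_kernel \<beta> s \<tau> * w \<tau> * w s))"
  proof (cases "0 \<le> \<tau> \<and> \<tau> < s")
    case True
    then show ?thesis
      using 1[of "w \<tau> * w s"] by (simp add: laplace_integrand_def mult.assoc)
  qed (auto simp add: laplace_integrand_def abel_kernel_def)
  show "has_bochner_integral lborel (\<lambda>r. \<bar>laplace_integrand \<beta> (s, \<tau>) r\<bar>)
      (Gamma (1 - \<beta>) * (\<bar>abel_kernel \<beta> s \<tau> * w \<tau> * w s\<bar>))"
  proof (cases "0 \<le> \<tau> \<and> \<tau> < s")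
    case True
    then show ?thesis
      using 1[of "\<bar>w \<tau> * w s\<bar>"] abel_kernel_nonneg[of \<beta> s \<tau>]
      by (simp add: laplace_integrand_def mult.assoc abs_mult)
  qed (auto simp add: laplace_integrand_def abel_kernel_def)
qed

lemma laplace_integrand_measurable [measurable]:
  "(\<lambda>(p, r). laplace_integrand \<beta> p r) \<in> borel_measurable ((borel \<Otimes>\<^sub>M borel) \<Otimes>\<^sub>M borel)"
  unfolding laplace_integrand_def by measurable

text \<open>The inner integral of the absolute value is bounded by a constant for \<open>s\<close>
  in \<open>{0..b}\<close> and vanishes elsewhere, since \<open>w s\<close> is a factor.\<close>

lemma integrable_abel_form:
  assumes "0 < \<beta>"
  shows "integrable (lborel \<Otimes>\<^sub>M lborel) (\<lambda>p. abel_kernel \<beta> (fst p) (snd p) * w (snd p) * w (fst p))"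
proof (rule lborel_pair.Fubini_integrable)
  show "AE s in lborel. integrable lborel (\<lambda>\<tau>. abel_kernel \<beta> (fst (s, \<tau>)) (snd (s, \<tau>)) * w (snd (s, \<tau>)) * w (fst (s, \<tau>)))"
    using integrable_abel_kernel_mult[OF assms] by (intro AE_I2) simp
  define C where "C = M * (b powr \<beta> / \<beta>) * M"
  have C: "(LINT \<tau>|lborel. norm (abel_kernel \<beta> s \<tau> * w \<tau> * w s)) \<le> C" if "s \<in> {0..b}" for s
  proof -
    have "(LINT \<tau>|lborel. norm (abel_kernel \<beta> s \<tau> * w \<tau> * w s))
        = (LINT \<tau>|lborel. \<bar>abel_kernel \<beta> s \<tau> * w \<tau>\<bar>) * \<bar>w s\<bar>"
      by (simp add: norm_mult abs_mult)
    also have "\<dots> \<le> (M * (s powr \<beta> / \<beta>)) * M"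
      using abs_abel_le(1)[OF assms(1)] that bounded M_nonneg assms
      by (intro mult_mono) auto
    also have "\<dots> \<le> C"
      unfolding C_def using that assms M_nonneg
      by (intro mult_right_mono mult_left_mono divide_right_mono powr_mono2) auto
    finally show ?thesis .
  qed
  show "integrable lborel (\<lambda>s. LINT \<tau>|lborel. norm (abel_kernel \<beta> (fst (s, \<tau>)) (snd (s, \<tau>)) * w (snd (s, \<tau>)) * w (fst (s, \<tau>))))"
  proof (rule Bochner_Integration.integrable_bound)
    show "integrable lborel (\<lambda>s. indicator {0..b} s * C)"
      by (intro integrable_mult_left integrable_real_indicator) (simp_all add: emeasure_lborel_Icc_eq)
    show "AE s in lborel. norm (LINT \<tau>|lborel. norm (abel_kernel \<beta> (fst (s, \<tau>)) (snd (s, \<tau>)) * w (snd (s, \<tau>)) * w (fst (s, \<tau>)))) \<le> norm (indicator {0..b} s * C)"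
    proof (rule AE_I2)
      fix s
      show "norm (LINT \<tau>|lborel. norm (abel_kernel \<beta> (fst (s, \<tau>)) (snd (s, \<tau>)) * w (snd (s, \<tau>)) * w (fst (s, \<tau>)))) \<le> norm (indicator {0..b} s * C)"
      proof (cases "s \<in> {0..b}")
        case True
        then show ?thesis
          using order_trans[OF C[OF True] abs_ge_self] by simp
      qed (simp add: support)
    qed
  qed measurable
qed measurable

text \<open>With \<open>r\<close> integrated out first, the absolute value becomes exactly a
  multiple of the absolute Abel integrand, which is already known to be integrable.\<close>

lemma integrable_laplace_integrand:
  assumes "0 < \<beta>" "\<beta> < 1"
  shows "integrable ((lborel \<Otimes>\<^sub>M lborel) \<Otimes>\<^sub>M lborel) (\<lambda>(p, r). laplace_integrand \<beta> p r)"
proof -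
  interpret P: pair_sigma_finite "lborel \<Otimes>\<^sub>M lborel :: (real \<times> real) measure" "lborel :: real measure"
    unfolding lborel_prod by unfold_locales
  show ?thesis
  proof (rule P.Fubini_integrable)
    have eq: "(\<lambda>p. LINT r|lborel. norm (case (p, r) of (p, r) \<Rightarrow> laplace_integrand \<beta> p r))
      = (\<lambda>p. Gamma (1 - \<beta>) * \<bar>abel_kernel \<beta> (fst p) (snd p) * w (snd p) * w (fst p)\<bar>)"
      using has_bochner_integral_laplace_integrand(2)[OF assms, THEN has_bochner_integral_integral_eq]
      by (auto simp: fun_eq_iff)
    show "integrable (lborel \<Otimes>\<^sub>M lborel) (\<lambda>p. LINT r|lborel. norm (case (p, r) of (p, r) \<Rightarrow> laplace_integrand \<beta> p r))"
      unfolding eq by (intro integrable_mult_right integrable_abs integrable_abel_form assms(1))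
    show "AE p in lborel \<Otimes>\<^sub>M lborel. integrable lborel (\<lambda>r. case (p, r) of (p, r) \<Rightarrow> laplace_integrand \<beta> p r)"
      using has_bochner_integral_laplace_integrand(1)[OF assms, THEN integrable.intros]
      by (intro AE_I2) auto
  qed measurable
qed

text \<open>At fixed \<open>r\<close> the exponential splits into a factor in \<open>s\<close> and a
  factor in \<tau>, so the inner integral rebuilds \<open>exp_conv\<close>. Integrability is assumed
  for the single \<open>r\<close> at hand, because Fubini supplies it for almost every
  \<open>r\<close>.\<close>

lemma integral_laplace_integrand:
  assumes "integrable (lborel \<Otimes>\<^sub>M lborel) (\<lambda>p. laplace_integrand \<beta> p r)"
  shows "(LINT p|(lborel \<Otimes>\<^sub>M lborel). laplace_integrand \<beta> p r)
    = indicator {0..} r * r powr (- \<beta>) * exp_energy r"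
proof -
  define c where "c = indicator {0..} r * r powr (- \<beta>)"
  have inner: "(LINT \<tau>|lborel. laplace_integrand \<beta> (s, \<tau>) r)
      = indicator {0..b} s *\<^sub>R (c * (exp_conv r s * w s))" for s
  proof (cases "s \<in> {0..b}")
    case True
    have "(LINT \<tau>|lborel. laplace_integrand \<beta> (s, \<tau>) r) =
       (LINT \<tau>|lborel. (c * exp (- (r * s)) * w s) * (indicator {0..s} \<tau> *\<^sub>R (exp (r * \<tau>) * w \<tau>)))"
    proof (rule integral_cong_AE)
      \<comment> \<open>The cut \<tau> < s is strict while \<open>{0..s}\<close> is closed, so the
        null set consisting of \<open>s\<close> is left out.\<close>
      have eq: "laplace_integrand \<beta> (s, \<tau>) r
          = (c * exp (- (r * s)) * w s) * (indicator {0..s} \<tau> *\<^sub>R (exp (r * \<tau>) * w \<tau>))" if "\<tau> \<noteq> s" for \<tau>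
      proof -
        have "exp (- (r * (s - \<tau>))) = exp (- (r * s)) * exp (r * \<tau>)"
          by (simp add: algebra_simps flip: exp_add)
        then show ?thesis
          using that by (auto simp: laplace_integrand_def c_def indicator_def)
      qed
      show "AE \<tau> in lborel. laplace_integrand \<beta> (s, \<tau>) r
          = (c * exp (- (r * s)) * w s) * (indicator {0..s} \<tau> *\<^sub>R (exp (r * \<tau>) * w \<tau>))"
        by (rule eventually_mono[OF AE_lborel_singleton[of s] eq])
      show "(\<lambda>\<tau>. laplace_integrand \<beta> (s, \<tau>) r) \<in> borel_measurable lborel"
        unfolding laplace_integrand_def fst_conv snd_conv by measurable
      show "(\<lambda>\<tau>. c * exp (- (r * s)) * w s * (indicator {0..s} \<tau> *\<^sub>R (exp (r * \<tau>) * w \<tau>)))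
          \<in> borel_measurable lborel"
        by measurable
    qed
    also have "\<dots> = (c * exp (- (r * s)) * w s) * (LINT \<tau>:{0..s}|lborel. exp (r * \<tau>) * w \<tau>)"
      by (simp add: set_lebesgue_integral_def)
    also have "(LINT \<tau>:{0..s}|lborel. exp (r * \<tau>) * w \<tau>) = integral {0..s} (\<lambda>\<tau>. exp (r * \<tau>) * w \<tau>)"
      by (intro set_borel_integral_eq_integral(2) set_integrable_mult_continuous continuous_intros)
    finally show ?thesis
      using True by (simp add: exp_conv_def)
  qed (simp add: laplace_integrand_def support cong: if_cong)
  have "integrable lborel (\<lambda>s. LINT \<tau>|lborel. laplace_integrand \<beta> (s, \<tau>) r)"
    using lborel_pair.integrable_fst'[OF assms] .
  then have int: "set_integrable lborel {0..b} (\<lambda>s. c * (exp_conv r s * w s))"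
    by (simp only: inner set_integrable_def)
  have "(LINT p|(lborel \<Otimes>\<^sub>M lborel). laplace_integrand \<beta> p r)
      = (LINT s|lborel. LINT \<tau>|lborel. laplace_integrand \<beta> (s, \<tau>) r)"
    using lborel_pair.integral_fst'[OF assms] by simp
  also have "\<dots> = (LINT s:{0..b}|lborel. c * (exp_conv r s * w s))"
    by (simp only: inner set_lebesgue_integral_def)
  also have "\<dots> = integral {0..b} (\<lambda>s. c * (exp_conv r s * w s))"
    using set_borel_integral_eq_integral(2)[OF int] .
  also have "\<dots> = c * exp_energy r"
    by (simp add: exp_energy_def)
  finally show ?thesis
    by (simp add: c_def)
qed

text \<open>\<open>G\<close> stays an unevaluated integral: Fubini then gives its measurability and
  integrability, and the closed form is claimed almost everywhere. The Gamma factors come from the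
  Laplace integral and from the definition of the fractional integral.\<close>

lemma abel_form_laplace:
  assumes "0 < \<beta>" "\<beta> < 1"
  defines "G \<equiv> \<lambda>r. LINT p|(lborel \<Otimes>\<^sub>M lborel). laplace_integrand \<beta> p r"
  shows "integral {0..b} (\<lambda>s. frac_integral \<beta> w s * w s)
      = (LINT r|lborel. G r) / (Gamma (1 - \<beta>) * Gamma \<beta>)"
    and "integrable lborel G"
    and "AE r in lborel. G r = indicator {0..} r * r powr (- \<beta>) * exp_energy r"
proof -
  interpret P: pair_sigma_finite "lborel \<Otimes>\<^sub>M lborel :: (real \<times> real) measure" "lborel :: real measure"
    unfolding lborel_prod by unfold_locales
  note int = integrable_laplace_integrand[OF assms(1,2)]
  show "AE r in lborel. G r = indicator {0..} r * r powr (- \<beta>) * exp_energy r"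
    using P.AE_integrable_snd[OF int] by eventually_elim (simp add: G_def integral_laplace_integrand)
  show "integrable lborel G"
    unfolding G_def using P.integrable_snd[OF int] .
  have "(LINT r|lborel. G r)
      = (LINT p|(lborel \<Otimes>\<^sub>M lborel). Gamma (1 - \<beta>) * (abel_kernel \<beta> (fst p) (snd p) * w (snd p) * w (fst p)))"
    unfolding G_def P.Fubini_integral[OF int]
    using has_bochner_integral_laplace_integrand(1)[OF assms(1,2), THEN has_bochner_integral_integral_eq]
    by (intro Bochner_Integration.integral_cong) (auto simp: split_beta)
  also have "\<dots> = Gamma (1 - \<beta>) * (LINT p|(lborel \<Otimes>\<^sub>M lborel). abel_kernel \<beta> (fst p) (snd p) * w (snd p) * w (fst p))"
    by (rule integral_mult_right_zero)
  also have "(LINT p|(lborel \<Otimes>\<^sub>M lborel). abel_kernel \<beta> (fst p) (snd p) * w (snd p) * w (fst p))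
      = (LINT s|lborel. abel \<beta> s * w s)"
    using lborel_pair.integral_fst'[OF integrable_abel_form[OF assms(1)]] by (simp add: abel_def)
  also have "\<dots> = (LINT s:{0..b}|lborel. abel \<beta> s * w s)"
    unfolding set_lebesgue_integral_def
  proof (rule Bochner_Integration.integral_cong[OF refl])
    show "abel \<beta> s * w s = indicator {0..b} s *\<^sub>R (abel \<beta> s * w s)" for s
      by (cases "s \<in> {0..b}") (simp_all add: support)
  qed
  also have "\<dots> = integral {0..b} (\<lambda>s. abel \<beta> s * w s)"
    by (intro set_borel_integral_eq_integral(2) set_integrable_abel_mult[OF assms(1) _ bounded]) simp
  also have "\<dots> = integral {0..b} (\<lambda>s. Gamma \<beta> * (frac_integral \<beta> w s * w s))"
    using assms(1) by (simp add: frac_integral_eq_abel(1) Gamma_real_pos[THEN less_imp_neq, symmetric])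
  finally show "integral {0..b} (\<lambda>s. frac_integral \<beta> w s * w s)
      = (LINT r|lborel. G r) / (Gamma (1 - \<beta>) * Gamma \<beta>)"
    using Gamma_real_pos[of \<beta>, THEN less_imp_neq] Gamma_real_pos[of "1 - \<beta>", THEN less_imp_neq] assms(1,2)
    by auto
qed

lemma frac_integral_form_nonneg:
  assumes "0 < \<beta>" "\<beta> < 1"
  shows "0 \<le> integral {0..b} (\<lambda>s. frac_integral \<beta> w s * w s)"
  unfolding abel_form_laplace(1)[OF assms]
proof (intro divide_nonneg_pos integral_nonneg_AE)
  show "AE r in lborel. 0 \<le> (LINT p|(lborel \<Otimes>\<^sub>M lborel). laplace_integrand \<beta> p r)"
    using abel_form_laplace(3)[OF assms]
    by eventually_elim (simp add: exp_energy_nonneg indicator_def)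
qed (use assms in \<open>simp add: Gamma_real_pos\<close>)

text \<open>A nonnegative \<open>G\<close> with integral zero vanishes almost everywhere, so the
  energy vanishes for some positive \<open>r\<close>, and one such \<open>r\<close>
  suffices.\<close>

lemma frac_integral_form_eq_0_imp:
  assumes "0 < \<beta>" "\<beta> < 1"
    and "integral {0..b} (\<lambda>s. frac_integral \<beta> w s * w s) = 0" and "s \<in> {0<..<b} - S"
  shows "w s = 0"
proof -
  let ?G = "\<lambda>r. LINT p|(lborel \<Otimes>\<^sub>M lborel). laplace_integrand \<beta> p r"
  note AE = abel_form_laplace(3)[OF assms(1,2)]
  have "AE r in lborel. 0 \<le> ?G r"
    using AE by eventually_elim (simp add: exp_energy_nonneg indicator_def)
  moreover have "(LINT r|lborel. ?G r) = 0"
    using assms(1-3) Gamma_real_pos[of \<beta>, THEN less_imp_neq] Gamma_real_pos[of "1 - \<beta>", THEN less_imp_neq]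
    unfolding abel_form_laplace(1)[OF assms(1,2)] by auto
  ultimately have "AE r in lborel. ?G r = 0"
    using integral_nonneg_eq_0_iff_AE[OF abel_form_laplace(2)[OF assms(1,2)]] by simp
  with AE have zero: "AE r in lborel. 0 < r \<longrightarrow> exp_energy r = 0"
    by eventually_elim auto
  \<comment> \<open>Otherwise the interval from 0 to 1 would lie in the exceptional null
    set.\<close>
  have "\<exists>r>0. exp_energy r = 0"
  proof (rule ccontr)
    assume "\<not> ?thesis"
    with zero have "AE r in lborel. r \<notin> {0<..<1::real}"
      by (auto elim!: eventually_mono)
    then have "{0<..<1::real} \<in> null_sets lborel"
      by (subst AE_iff_null_sets) auto
    then show False
      by (simp add: null_sets_def)
  qed
  then show ?thesis
    using exp_energy_eq_0_imp assms(4) by blast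
qed

end

text \<open>Nonnegativity of the form and positivity of the cosine make the square root of their
  quotient the unique candidate, so the definite description has its defining property.\<close>

lemma neg_sobolev_norm_square:
  assumes "0 < \<alpha>" "\<alpha> < 1" and "0 \<le> integral {0..b} (\<lambda>s. frac_integral (1 - \<alpha>) v s * v s)"
  shows "cos ((\<alpha> - 1) * pi / 2) * (neg_sobolev_norm \<alpha> b v)\<^sup>2
    = integral {0..b} (\<lambda>s. frac_integral (1 - \<alpha>) v s * v s)" (is "?c * _ = ?Q")
proof -
  \<comment> \<open>This keeps the argument of the cosine above \<open>- pi / 2\<close>.\<close>
  have "(1 - \<alpha>) * pi < 1 * pi"
    using assms by (intro mult_strict_right_mono) auto
  then have c: "0 < ?c"
    using assms by (intro cos_gt_zero_pi) (auto simp: algebra_simps)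
  have "?c * (THE N. 0 \<le> N \<and> ?Q = ?c * N\<^sup>2)\<^sup>2 = ?Q"
  proof (rule theI2[where a = "sqrt (?Q / ?c)"])
    show "0 \<le> sqrt (?Q / ?c) \<and> ?Q = ?c * (sqrt (?Q / ?c))\<^sup>2"
      using c assms(3) by simp
    show "N = sqrt (?Q / ?c)" if "0 \<le> N \<and> ?Q = ?c * N\<^sup>2" for N
      using c that by (simp add: real_sqrt_unique)
  qed simp
  then show ?thesis
    by (simp only: neg_sobolev_norm_def)
qed

section \<open>Piecewise polynomials on a mesh\<close>

lemma ldg_solutionD:
  assumes "ldg_solution \<alpha> A B n t k x0 X0 X1" "j \<in> {1..n}"
  shows "X0 \<in> dg_space n t k" and "X1 \<in> dg_space n t k"
    and "v \<in> dg_space n t k \<Longrightarrow>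
      (ltrace x0 t X0 j * Lim (at_left (t j)) v - ltrace x0 t X0 (j - 1) * rtrace t v (j - 1))
        - cell_inner t j X1 v - cell_inner t j X0 (deriv v) = 0"
    and "v \<in> dg_space n t k \<Longrightarrow>
      cell_inner t j (frac_integral (1 - \<alpha>) X1) v = cell_inner t j (\<lambda>s. A * X0 s + B s) v"
  using assms by (simp_all add: ldg_solution_def)

locale dg_mesh =
  fixes T :: real and n :: nat and t :: "nat \<Rightarrow> real"
  assumes mesh: "mesh T n t"
begin

lemma t_less: "i < j \<Longrightarrow> j \<le> n \<Longrightarrow> t i < t j"
proof (induction j)
  case (Suc j)
  then have "t j < t (Suc j)" and "i = j \<or> t i < t j"
    using mesh by (auto simp: mesh_def less_Suc_eq)
  then show ?case
    by auto
qed simp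

lemma t_mono: "i \<le> j \<Longrightarrow> j \<le> n \<Longrightarrow> t i \<le> t j"
  using t_less[of i j] by (cases "i = j") auto

lemma t_0: "t 0 = 0" and t_n: "t n = T" and n_pos: "1 \<le> n"
  using mesh by (auto simp: mesh_def)

lemma cell_nonempty: "j \<in> {1..n} \<Longrightarrow> t (j - 1) < t j"
  by (rule t_less) auto

lemma cell_subset:
  assumes "j \<in> {1..m}" "m \<le> n"
  shows "cell t j \<subseteq> {0<..<t m}"
proof -
  have "0 \<le> t (j - 1)" "t j \<le> t m"
    using t_mono[of 0 "j - 1"] t_mono[of j m] assms t_0 by auto
  then show ?thesis
    by (auto simp: cell_def)
qed

lemma mesh_complement_subset:
  assumes "m \<le> n"
  shows "{0..t m} - t ` {..n} \<subseteq> {0<..<t m} - t ` {..n}"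
proof
  fix s assume s: "s \<in> {0..t m} - t ` {..n}"
  then have "s \<noteq> t 0" "s \<noteq> t m"
    using assms by auto
  then show "s \<in> {0<..<t m} - t ` {..n}"
    using s t_0 by auto
qed

lemma cell_cover:
  assumes "m \<le> n" "s \<in> {0<..<t m} - t ` {..n}"
  shows "\<exists>j\<in>{1..m}. s \<in> cell t j"
  using assms
proof (induction m)
  case 0
  then show ?case by (simp add: t_0)
next
  case (Suc m)
  show ?case
  proof (cases "s < t m")
    case True
    then obtain j where "j \<in> {1..m}" "s \<in> cell t j"
      using Suc by auto
    then show ?thesis
      by (intro bexI[of _ j]) auto
  next
    case False
    moreover have "s \<noteq> t m"
      using Suc.prems by auto
    ultimately show ?thesis
      using Suc.prems by (intro bexI[of _ "Suc m"]) (auto simp: cell_def)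
  qed
qed

lemma dg_spaceE:
  assumes "v \<in> dg_space n t k" "j \<in> {1..n}"
  obtains p where "degree p \<le> k" "\<And>s. s \<in> cell t j \<Longrightarrow> v s = poly p s"
  using assms unfolding dg_space_def by blast

lemma dg_space_linear:
  assumes "u \<in> dg_space n t k" "v \<in> dg_space n t k"
  shows "(\<lambda>s. a * u s + b * v s) \<in> dg_space n t k"
  unfolding dg_space_def
proof (intro CollectI ballI)
  fix j assume j: "j \<in> {1..n}"
  obtain p where p: "degree p \<le> k" "\<And>s. s \<in> cell t j \<Longrightarrow> u s = poly p s"
    using dg_spaceE[OF assms(1) j] by blast
  obtain q where q: "degree q \<le> k" "\<And>s. s \<in> cell t j \<Longrightarrow> v s = poly q s"
    using dg_spaceE[OF assms(2) j] by blast
  show "\<exists>r. degree r \<le> k \<and> (\<forall>s\<in>cell t j. a * u s + b * v s = poly r s)"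
    using p q by (intro exI[of _ "smult a p + smult b q"])
      (auto intro!: degree_add_le order_trans[OF degree_smult_le])
qed

lemma tendsto_at_left_cell:
  assumes "j \<in> {1..n}" "\<And>s. s \<in> cell t j \<Longrightarrow> v s = poly p s"
  shows "(v \<longlongrightarrow> poly p (t j)) (at_left (t j))"
proof (rule Lim_transform_eventually)
  show "(poly p \<longlongrightarrow> poly p (t j)) (at_left (t j))"
    by (intro tendsto_intros)
  show "\<forall>\<^sub>F s in at_left (t j). poly p s = v s"
    using eventually_at_left_real[OF cell_nonempty[OF assms(1)]]
    by eventually_elim (use assms(2) in \<open>auto simp: cell_def\<close>)
qed

lemma tendsto_at_right_cell:
  assumes "j \<in> {1..n}" "\<And>s. s \<in> cell t j \<Longrightarrow> v s = poly p s"
  shows "(v \<longlongrightarrow> poly p (t (j - 1))) (at_right (t (j - 1)))"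
proof (rule Lim_transform_eventually)
  show "(poly p \<longlongrightarrow> poly p (t (j - 1))) (at_right (t (j - 1)))"
    by (intro tendsto_intros)
  show "\<forall>\<^sub>F s in at_right (t (j - 1)). poly p s = v s"
    using eventually_at_right_real[OF cell_nonempty[OF assms(1)]]
    by eventually_elim (use assms(2) in \<open>auto simp: cell_def\<close>)
qed

lemma traces_poly:
  assumes "j \<in> {1..n}" "\<And>s. s \<in> cell t j \<Longrightarrow> v s = poly p s"
  shows "ltrace c t v j = poly p (t j)" and "rtrace t v (j - 1) = poly p (t (j - 1))"
  using tendsto_Lim[OF _ tendsto_at_left_cell[OF assms]] tendsto_Lim[OF _ tendsto_at_right_cell[OF assms]] assms(1)
  by (auto simp: ltrace_def rtrace_def)

text \<open>At index 0 the trace is the prescribed value, so the initial data must be combined with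
  the same coefficients as the functions.\<close>

lemma ltrace_linear:
  assumes "u \<in> dg_space n t k" "v \<in> dg_space n t k" "j \<le> n"
  shows "ltrace (a * c + b * d) t (\<lambda>s. a * u s + b * v s) j = a * ltrace c t u j + b * ltrace d t v j"
proof (cases "j = 0")
  case False
  then have j: "j \<in> {1..n}"
    using assms by auto
  obtain p where p: "\<And>s. s \<in> cell t j \<Longrightarrow> u s = poly p s"
    using dg_spaceE[OF assms(1) j] by blast
  obtain q where q: "\<And>s. s \<in> cell t j \<Longrightarrow> v s = poly q s"
    using dg_spaceE[OF assms(2) j] by blast
  have "ltrace (a * c + b * d) t (\<lambda>s. a * u s + b * v s) j = poly (smult a p + smult b q) (t j)"
    by (rule traces_poly(1)[OF j]) (simp add: p q)
  then show ?thesis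
    by (simp add: traces_poly(1)[OF j p] traces_poly(1)[OF j q])
qed (simp add: ltrace_def)

lemma dg_space_bounded:
  assumes "v \<in> dg_space n t k"
  obtains M where "0 \<le> M" "\<And>j s. j \<in> {1..n} \<Longrightarrow> s \<in> cell t j \<Longrightarrow> \<bar>v s\<bar> \<le> M"
proof -
  have "bounded (\<Union>j\<in>{1..n}. v ` cell t j)"
  proof (intro bounded_UN ballI)
    fix j assume j: "j \<in> {1..n}"
    obtain p where p: "\<And>s. s \<in> cell t j \<Longrightarrow> v s = poly p s"
      using dg_spaceE[OF assms j] by blast
    have "bounded (poly p ` {t (j - 1)..t j})"
      by (intro compact_imp_bounded compact_continuous_image continuous_intros compact_Icc)
    then show "bounded (v ` cell t j)"
      by (rule bounded_subset) (auto simp: p cell_def)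
  qed simp
  then obtain M where "\<And>x. x \<in> (\<Union>j\<in>{1..n}. v ` cell t j) \<Longrightarrow> norm x \<le> M"
    by (auto simp: bounded_iff)
  then show ?thesis
    by (intro that[of "max M 0"]) force+
qed

text \<open>
  Functions in the discontinuous space are arbitrary at the mesh points and outside the mesh;
  cutting them off there makes them Borel measurable and bounded.
\<close>

definition cell_part :: "nat \<Rightarrow> (real \<Rightarrow> real) \<Rightarrow> real \<Rightarrow> real" where
  "cell_part m v s = (if \<exists>j\<in>{1..m}. s \<in> cell t j then v s else 0)"

lemma cell_part_eq:
  assumes "m \<le> n" "s \<in> {0..t m} - t ` {..n}"
  shows "cell_part m v s = v s"
proof -
  have "\<exists>j\<in>{1..m}. s \<in> cell t j"
    using cell_cover[OF assms(1)] mesh_complement_subset[OF assms(1)] assms(2) by blast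
  then show ?thesis
    by (simp only: cell_part_def if_True)
qed

text \<open>A point off the mesh lies in an open cell, where the function is a polynomial, or in the
  open complement of the interval, where the cut-off is zero. The bound is uniform because there are
  finitely many cells.\<close>

lemma cell_part_piecewise_continuous:
  assumes "v \<in> dg_space n t k" "m \<in> {1..n}"
  obtains M where "piecewise_continuous_on_interval (cell_part m v) (t m) M (t ` {..n})"
proof -
  obtain M where M: "0 \<le> M" "\<And>j s. j \<in> {1..n} \<Longrightarrow> s \<in> cell t j \<Longrightarrow> \<bar>v s\<bar> \<le> M"
    using dg_space_bounded[OF assms(1)] by blast
  have "piecewise_continuous_on_interval (cell_part m v) (t m) M (t ` {..n})"
  proof
    show "0 < t m"
      using t_less[of 0 m] assms(2) t_0 by auto
    show "\<bar>cell_part m v s\<bar> \<le> M" for s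
    proof (cases "\<exists>j\<in>{1..m}. s \<in> cell t j")
      case True
      then obtain j where j: "j \<in> {1..m}" "s \<in> cell t j" ..
      then have "\<bar>v s\<bar> \<le> M"
        using assms(2) by (intro M(2)[of j]) auto
      then show ?thesis
        using True by (simp only: cell_part_def if_True)
    qed (use M(1) in \<open>simp add: cell_part_def\<close>)
    show "cell_part m v s = 0" if "s \<notin> {0..t m}" for s
      using cell_subset[of _ m] that assms(2) by (fastforce simp: cell_part_def)
    have "continuous (at s) (cell_part m v)" if s: "s \<notin> t ` {..n}" for s
    proof (cases "s \<in> {0<..<t m}")
      case True
      then obtain j where j: "j \<in> {1..m}" "s \<in> cell t j"
        using cell_cover[of m s] s assms(2) by auto
      obtain p where p: "\<And>s. s \<in> cell t j \<Longrightarrow> v s = poly p s"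
        using dg_spaceE[OF assms(1), of j] j assms(2) by auto
      have "continuous_on (cell t j) (cell_part m v) \<longleftrightarrow> continuous_on (cell t j) (poly p)"
        using j p by (intro continuous_on_cong refl) (auto simp: cell_part_def)
      moreover have "open (cell t j)"
        by (simp add: cell_def)
      ultimately show ?thesis
        using j(2) by (simp add: continuous_on_eq_continuous_at continuous_intros)
    next
      case False
      have "s \<noteq> t 0" "s \<noteq> t m"
        using s assms(2) by auto
      then have "s \<in> - {0..t m}"
        using False t_0 by auto
      moreover have "open (- {0..t m})"
        by (simp add: open_Compl)
      moreover have "continuous_on (- {0..t m}) (cell_part m v) \<longleftrightarrow> continuous_on (- {0..t m}) (\<lambda>_. 0 :: real)"
        using cell_subset[of _ m] assms(2)
        by (intro continuous_on_cong refl) (fastforce simp: cell_part_def)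
      ultimately show ?thesis
        by (simp add: continuous_on_eq_continuous_at)
    qed
    then show "continuous_on (- t ` {..n}) (cell_part m v)"
      by (simp add: continuous_at_imp_continuous_on)
  qed simp
  then show ?thesis
    using that by blast
qed

lemma negligible_mesh: "negligible (t ` {..n})"
  by (simp add: negligible_finite)

section \<open>Fractional integrals and products of piecewise polynomials\<close>

lemma frac_integral_cell_part:
  assumes "m \<le> n" "s \<le> t m"
  shows "frac_integral \<beta> (cell_part m v) s = frac_integral \<beta> v s"
proof -
  have "integral {0..s} (\<lambda>\<tau>. (s - \<tau>) powr (\<beta> - 1) * cell_part m v \<tau>)
      = integral {0..s} (\<lambda>\<tau>. (s - \<tau>) powr (\<beta> - 1) * v \<tau>)"
    by (rule integral_spike[OF negligible_mesh]) (use assms cell_part_eq[OF assms(1)] in auto)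
  then show ?thesis
    by (simp add: frac_integral_def)
qed

text \<open>Up to \<open>t m\<close> the cut-off changes the function at mesh points only, so the
  form is unaffected and positivity carries over; vanishing is therefore asserted off the mesh
  points.\<close>

lemma frac_integral_form:
  assumes "v \<in> dg_space n t k" "m \<in> {1..n}" "0 < \<beta>" "\<beta> < 1"
  shows "(\<lambda>s. frac_integral \<beta> v s * v s) integrable_on {0..t m}"
    and "0 \<le> integral {0..t m} (\<lambda>s. frac_integral \<beta> v s * v s)"
    and "integral {0..t m} (\<lambda>s. frac_integral \<beta> v s * v s) = 0 \<Longrightarrow>
      s \<in> {0..t m} - t ` {..n} \<Longrightarrow> v s = 0"
proof -
  obtain M where "piecewise_continuous_on_interval (cell_part m v) (t m) M (t ` {..n})"
    using cell_part_piecewise_continuous[OF assms(1,2)] by blast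
  then interpret piecewise_continuous_on_interval "cell_part m v" "t m" M "t ` {..n}" .
  have m: "m \<le> n" using assms(2) by simp
  have eq: "frac_integral \<beta> v s * v s = frac_integral \<beta> (cell_part m v) s * cell_part m v s"
    if "s \<in> {0..t m} - t ` {..n}" for s
    using that cell_part_eq[OF m that] frac_integral_cell_part[OF m] by simp
  have "(\<lambda>s. frac_integral \<beta> (cell_part m v) s * cell_part m v s) absolutely_integrable_on {0..t m}"
    by (intro absolutely_integrable_frac_integral_mult[OF assms(3) _ bounded]) auto
  then have "(\<lambda>s. frac_integral \<beta> (cell_part m v) s * cell_part m v s) integrable_on {0..t m}"
    by (rule set_lebesgue_integral_eq_integral(1))
  then show "(\<lambda>s. frac_integral \<beta> v s * v s) integrable_on {0..t m}"
    by (rule integrable_spike[OF _ negligible_mesh]) (rule eq)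
  have int_eq: "integral {0..t m} (\<lambda>s. frac_integral \<beta> v s * v s)
      = integral {0..t m} (\<lambda>s. frac_integral \<beta> (cell_part m v) s * cell_part m v s)"
    by (rule integral_spike[OF negligible_mesh]) (simp only: eq)
  show "0 \<le> integral {0..t m} (\<lambda>s. frac_integral \<beta> v s * v s)"
    unfolding int_eq using frac_integral_form_nonneg[OF assms(3,4)] .
  show "v s = 0" if "integral {0..t m} (\<lambda>s. frac_integral \<beta> v s * v s) = 0"
    and s: "s \<in> {0..t m} - t ` {..n}"
  proof -
    have "cell_part m v s = 0"
      using frac_integral_form_eq_0_imp[OF assms(3,4)] that mesh_complement_subset[OF m]
      unfolding int_eq by blast
    then show ?thesis
      using cell_part_eq[OF m s] by simp
  qed
qed

lemma frac_integral_linear: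
  assumes "u \<in> dg_space n t k" "v \<in> dg_space n t k" "0 < \<beta>" "s \<le> t n"
  shows "frac_integral \<beta> (\<lambda>s. a * u s + b * v s) s = a * frac_integral \<beta> u s + b * frac_integral \<beta> v s"
proof -
  have int: "(\<lambda>\<tau>. (s - \<tau>) powr (\<beta> - 1) * v \<tau>) integrable_on {0..s}" if v: "v \<in> dg_space n t k" for v
  proof -
    obtain M where "piecewise_continuous_on_interval (cell_part n v) (t n) M (t ` {..n})"
      using cell_part_piecewise_continuous[OF v, of n] n_pos by auto
    then have "(\<lambda>\<tau>. (s - \<tau>) powr (\<beta> - 1) * cell_part n v \<tau>) integrable_on {0..s}"
      using piecewise_continuous_on_interval.frac_integral_eq_abel(2)[OF _ assms(3)] by blast
    then show ?thesis
      by (rule integrable_spike[OF _ negligible_mesh])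
        (use assms(4) cell_part_eq[OF order_refl, of _ v] in auto)
  qed
  have "integral {0..s} (\<lambda>\<tau>. (s - \<tau>) powr (\<beta> - 1) * (a * u \<tau> + b * v \<tau>))
      = integral {0..s} (\<lambda>\<tau>. a * ((s - \<tau>) powr (\<beta> - 1) * u \<tau>) + b * ((s - \<tau>) powr (\<beta> - 1) * v \<tau>))"
    by (simp add: algebra_simps)
  also have "\<dots> = a * integral {0..s} (\<lambda>\<tau>. (s - \<tau>) powr (\<beta> - 1) * u \<tau>)
      + b * integral {0..s} (\<lambda>\<tau>. (s - \<tau>) powr (\<beta> - 1) * v \<tau>)"
    by (subst integral_add) (auto intro!: integrable_on_mult_right int assms)
  finally show ?thesis
    by (simp add: frac_integral_def algebra_simps)
qed

lemma dg_space_cell_measurable: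
  assumes "v \<in> dg_space n t k" "j \<in> {1..n}"
  obtains g L where "g \<in> borel_measurable borel" "\<And>s. \<bar>g s\<bar> \<le> L" "\<And>s. s \<in> cell t j \<Longrightarrow> g s = v s"
proof -
  obtain M where "piecewise_continuous_on_interval (cell_part n v) (t n) M (t ` {..n})"
    using cell_part_piecewise_continuous[OF assms(1), of n] n_pos by auto
  then interpret piecewise_continuous_on_interval "cell_part n v" "t n" M "t ` {..n}" .
  show ?thesis
    by (rule that[OF w_measurable bounded]) (use assms(2) in \<open>auto simp: cell_part_def\<close>)
qed

text \<open>A bounded measurable factor preserves absolute integrability; \<open>g\<close> stands in
  for \<open>v\<close>, whose values off the open cells are arbitrary. The three cases are the left
  factors occurring in the scheme: piecewise polynomial, fractional integral, source.\<close>

lemma cell_mult_integrable: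
  assumes "v \<in> dg_space n t k" "j \<in> {1..n}"
  shows "u \<in> dg_space n t k \<Longrightarrow> (\<lambda>s. u s * v s) integrable_on cell t j"
    and "u \<in> dg_space n t k \<Longrightarrow> 0 < \<beta> \<Longrightarrow> (\<lambda>s. frac_integral \<beta> u s * v s) integrable_on cell t j"
    and "f absolutely_integrable_on {0..T} \<Longrightarrow> (\<lambda>s. f s * v s) integrable_on cell t j"
proof -
  obtain g L where g: "g \<in> borel_measurable borel" "\<And>s. \<bar>g s\<bar> \<le> L" "\<And>s. s \<in> cell t j \<Longrightarrow> g s = v s"
    using dg_space_cell_measurable[OF assms] by blast
  have sub: "cell t j \<subseteq> {0..t n}"
    using cell_subset[OF assms(2)] by force
  show *: "(\<lambda>s. f s * v s) integrable_on cell t j" if f: "f absolutely_integrable_on {0..T}" for f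
  proof -
    have "f absolutely_integrable_on cell t j"
      using set_integrable_subset[OF f _ sub[unfolded t_n]] by (simp add: cell_def)
    then have "(\<lambda>s. g s * f s) absolutely_integrable_on cell t j"
      using g(1,2) by (intro absolutely_integrable_bounded_measurable_product_real)
        (auto simp: cell_def bounded_iff intro!: measurable_restrict_space1 measurable_completion)
    then have "(\<lambda>s. g s * f s) integrable_on cell t j"
      by (rule set_lebesgue_integral_eq_integral(1))
    then show ?thesis
      by (rule integrable_eq) (simp add: g(3))
  qed
  show "(\<lambda>s. u s * v s) integrable_on cell t j" if u: "u \<in> dg_space n t k"
  proof -
    obtain p where p: "\<And>s. s \<in> cell t j \<Longrightarrow> u s = poly p s"
      using dg_spaceE[OF u assms(2)] by blast
    have "(\<lambda>s. poly p s * v s) integrable_on cell t j"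
      by (intro * absolutely_integrable_continuous_real continuous_intros)
    then show ?thesis
      by (rule integrable_eq) (simp add: p)
  qed
  show "(\<lambda>s. frac_integral \<beta> u s * v s) integrable_on cell t j"
    if u: "u \<in> dg_space n t k" and \<beta>: "0 < \<beta>"
  proof -
    obtain M where "piecewise_continuous_on_interval (cell_part n u) (t n) M (t ` {..n})"
      using cell_part_piecewise_continuous[OF u, of n] n_pos by auto
    then interpret piecewise_continuous_on_interval "cell_part n u" "t n" M "t ` {..n}" .
    have "(\<lambda>s. frac_integral \<beta> (cell_part n u) s * g s) absolutely_integrable_on cell t j"
      by (rule absolutely_integrable_frac_integral_mult[OF \<beta> g(1,2) sub]) (simp add: cell_def)
    then have "(\<lambda>s. frac_integral \<beta> (cell_part n u) s * g s) integrable_on cell t j"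
      by (rule set_lebesgue_integral_eq_integral(1))
    then show ?thesis
      by (rule integrable_eq) (use sub in \<open>auto simp: g(3) frac_integral_cell_part\<close>)
  qed
qed

lemma cell_inner_linear:
  assumes "(\<lambda>s. f s * v s) integrable_on cell t j" "(\<lambda>s. g s * v s) integrable_on cell t j"
    and "\<And>s. s \<in> cell t j \<Longrightarrow> h s = a * f s + b * g s"
  shows "cell_inner t j h v = a * cell_inner t j f v + b * cell_inner t j g v"
proof -
  have "cell_inner t j h v = integral (cell t j) (\<lambda>s. a * (f s * v s) + b * (g s * v s))"
    unfolding cell_inner_def by (intro integral_cong) (simp add: assms(3) algebra_simps)
  also have "\<dots> = a * cell_inner t j f v + b * cell_inner t j g v"
    unfolding cell_inner_def
    by (subst integral_add) (auto intro!: integrable_on_mult_right assms)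
  finally show ?thesis .
qed

lemma deriv_eq_poly_pderiv:
  assumes "\<And>s. s \<in> cell t j \<Longrightarrow> v s = poly p s" "s \<in> cell t j"
  shows "deriv v s = poly (pderiv p) s"
proof (rule DERIV_imp_deriv)
  show "(v has_real_derivative poly (pderiv p) s) (at s)"
    by (rule has_field_derivative_transform_within_open[OF poly_DERIV _ assms(2)])
      (use assms(1) in \<open>auto simp: cell_def\<close>)
qed

text \<open>The one polynomial \<open>pderiv q\<close>, used on the whole line, replaces
  \<open>deriv v\<close>; being in the space, it is covered by the integrability results for
  products.\<close>

lemma cell_inner_deriv:
  assumes "v \<in> dg_space n t k" "j \<in> {1..n}"
  obtains v' where "v' \<in> dg_space n t k" "\<And>u. cell_inner t j u (deriv v) = cell_inner t j u v'"
proof -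
  obtain q where q: "degree q \<le> k" "\<And>s. s \<in> cell t j \<Longrightarrow> v s = poly q s"
    using dg_spaceE[OF assms] by blast
  have "deriv v s = poly (pderiv q) s" if "s \<in> cell t j" for s
    using deriv_eq_poly_pderiv[OF q(2) that] .
  moreover have "degree (pderiv q) \<le> k"
    using q(1) by (simp add: degree_pderiv)
  ultimately show ?thesis
    by (intro that[of "poly (pderiv q)"]) (auto simp: dg_space_def cell_inner_def intro!: integral_cong)
qed

text \<open>Combining the sources as well serves two purposes: a difference of solutions cancels
  \<open>B\<close>, and errors, whose source is zero, can be superposed. Integrability of the
  sources lets the cell integrals be split.\<close>

lemma ldg_solution_linear:
  assumes X: "ldg_solution \<alpha> A B n t k x0 X0 X1" and Y: "ldg_solution \<alpha> A D n t k y0 Y0 Y1"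
    and B: "B absolutely_integrable_on {0..T}" and D: "D absolutely_integrable_on {0..T}"
    and \<alpha>: "\<alpha> < 1"
  shows "ldg_solution \<alpha> A (\<lambda>s. a * B s + b * D s) n t k (a * x0 + b * y0)
    (\<lambda>s. a * X0 s + b * Y0 s) (\<lambda>s. a * X1 s + b * Y1 s)"
  unfolding ldg_solution_def
proof (intro conjI ballI)
  have V: "X0 \<in> dg_space n t k" "X1 \<in> dg_space n t k" "Y0 \<in> dg_space n t k" "Y1 \<in> dg_space n t k"
    using X Y by (auto simp: ldg_solution_def)
  show "(\<lambda>s. a * X0 s + b * Y0 s) \<in> dg_space n t k" "(\<lambda>s. a * X1 s + b * Y1 s) \<in> dg_space n t k"
    using V by (auto intro: dg_space_linear)
  fix v0 v1 j assume v: "v0 \<in> dg_space n t k" "v1 \<in> dg_space n t k" and j: "j \<in> {1..n}"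
  have jn: "j \<le> n" "j - 1 \<le> n" using j by auto
  obtain v0' where v0': "v0' \<in> dg_space n t k" "\<And>u. cell_inner t j u (deriv v0) = cell_inner t j u v0'"
    using cell_inner_deriv[OF v(1) j] by blast
  note X' = ldg_solutionD(3)[OF X j v(1)] ldg_solutionD(4)[OF X j v(2)]
  note Y' = ldg_solutionD(3)[OF Y j v(1)] ldg_solutionD(4)[OF Y j v(2)]
  have 1: "cell_inner t j (\<lambda>s. a * X1 s + b * Y1 s) v0 = a * cell_inner t j X1 v0 + b * cell_inner t j Y1 v0"
    by (intro cell_inner_linear cell_mult_integrable(1)[OF v(1) j] V refl)
  have 2: "cell_inner t j (\<lambda>s. a * X0 s + b * Y0 s) v0' = a * cell_inner t j X0 v0' + b * cell_inner t j Y0 v0'"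
    by (intro cell_inner_linear cell_mult_integrable(1)[OF v0'(1) j] V refl)
  have "a * ((ltrace x0 t X0 j * Lim (at_left (t j)) v0 - ltrace x0 t X0 (j - 1) * rtrace t v0 (j - 1))
          - cell_inner t j X1 v0 - cell_inner t j X0 v0')
      + b * ((ltrace y0 t Y0 j * Lim (at_left (t j)) v0 - ltrace y0 t Y0 (j - 1) * rtrace t v0 (j - 1))
          - cell_inner t j Y1 v0 - cell_inner t j Y0 v0') = 0"
    using X'(1) Y'(1) unfolding v0'(2) by simp
  then show "(ltrace (a * x0 + b * y0) t (\<lambda>s. a * X0 s + b * Y0 s) j * Lim (at_left (t j)) v0
        - ltrace (a * x0 + b * y0) t (\<lambda>s. a * X0 s + b * Y0 s) (j - 1) * rtrace t v0 (j - 1))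
      - cell_inner t j (\<lambda>s. a * X1 s + b * Y1 s) v0
      - cell_inner t j (\<lambda>s. a * X0 s + b * Y0 s) (deriv v0) = 0"
    unfolding v0'(2) 1 2 ltrace_linear[OF V(1,3) jn(1)] ltrace_linear[OF V(1,3) jn(2)]
    by (simp only: algebra_simps)
  have rhs: "(\<lambda>s. (A * X s + F s) * v1 s) integrable_on cell t j"
    if "X \<in> dg_space n t k" "F absolutely_integrable_on {0..T}" for X F
    using integrable_add[OF integrable_on_mult_right[OF cell_mult_integrable(1)[OF v(2) j that(1)], of A]
      cell_mult_integrable(3)[OF v(2) j that(2)]]
    by (simp add: algebra_simps)
  have "cell_inner t j (frac_integral (1 - \<alpha>) (\<lambda>s. a * X1 s + b * Y1 s)) v1
      = a * cell_inner t j (frac_integral (1 - \<alpha>) X1) v1 + b * cell_inner t j (frac_integral (1 - \<alpha>) Y1) v1"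
    using cell_subset[OF j] \<alpha>
    by (intro cell_inner_linear cell_mult_integrable(2)[OF v(2) j] V frac_integral_linear[OF V(2,4)]) force+
  also have "\<dots> = cell_inner t j (\<lambda>s. A * (a * X0 s + b * Y0 s) + (a * B s + b * D s)) v1"
    unfolding X'(2) Y'(2)
    by (intro cell_inner_linear[symmetric] rhs V B D) (simp add: algebra_simps)
  finally show "cell_inner t j (frac_integral (1 - \<alpha>) (\<lambda>s. a * X1 s + b * Y1 s)) v1
      = cell_inner t j (\<lambda>s. A * (a * X0 s + b * Y0 s) + (a * B s + b * D s)) v1" .
qed

section \<open>Energy identity and stability\<close>

lemma integral_pderiv:
  assumes "j \<in> {1..n}" "\<And>s. s \<in> cell t j \<Longrightarrow> f s = poly (pderiv p) s"
  shows "integral (cell t j) f = poly p (t j) - poly p (t (j - 1))"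
proof -
  have "integral (cell t j) f = integral (cell t j) (poly (pderiv p))"
    by (intro integral_cong assms(2))
  also have "\<dots> = integral {t (j - 1)..t j} (poly (pderiv p))"
    by (simp add: cell_def integral_open_interval_real)
  also have "\<dots> = poly p (t j) - poly p (t (j - 1))"
    using cell_nonempty[OF assms(1)]
    by (intro integral_unique fundamental_theorem_of_calculus)
      (auto simp flip: has_real_derivative_iff_has_vector_derivative intro!: has_field_derivative_at_within poly_DERIV)
  finally show ?thesis .
qed

text \<open>\<open>smult (1/2) (p * p)\<close> is an antiderivative of the product on the cell. The
  value \<open>c\<close> is free, since for \<open>j\<close> at least 1 the left trace is a genuine
  limit.\<close>

lemma cell_inner_deriv_self:
  assumes "v \<in> dg_space n t k" "j \<in> {1..n}"
  shows "cell_inner t j v (deriv v) = ((ltrace c t v j)\<^sup>2 - (rtrace t v (j - 1))\<^sup>2) / 2"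
proof -
  obtain p where p: "\<And>s. s \<in> cell t j \<Longrightarrow> v s = poly p s"
    using dg_spaceE[OF assms] by blast
  have "deriv v s = poly (pderiv p) s" if "s \<in> cell t j" for s
    using deriv_eq_poly_pderiv[OF p that] .
  then have "v s * deriv v s = poly (pderiv (smult (1/2) (p * p))) s" if "s \<in> cell t j" for s
    using that by (simp add: p pderiv_smult pderiv_mult)
  from integral_pderiv[OF assms(2) this] show ?thesis
    using traces_poly[OF assms(2) p] by (simp add: cell_inner_def power2_eq_square)
qed

text \<open>With left traces l and l' at the right and left ends of the cell and right trace r at
  the left end, twice the boundary terms are 2 l l - 2 l' r - (l l - r r). Completing the square
  gives l l - l' l' plus the square of the jump r - l', so the upwind flux produces the
  dissipation.\<close>

lemma cell_energy:
  assumes "ldg_solution \<alpha> A (\<lambda>_. 0) n t k d e0 e1" "A \<noteq> 0" "j \<in> {1..n}"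
  shows "(ltrace d t e0 j)\<^sup>2 = (ltrace d t e0 (j - 1))\<^sup>2 - (trace_jump d t e0 (j - 1))\<^sup>2
    + 2 / A * cell_inner t j (frac_integral (1 - \<alpha>) e1) e1"
proof -
  note e = ldg_solutionD[OF assms(1,3)]
  let ?l = "ltrace d t e0 j" and ?l' = "ltrace d t e0 (j - 1)" and ?r = "rtrace t e0 (j - 1)"
  let ?q = "cell_inner t j (frac_integral (1 - \<alpha>) e1) e1"
  have "Lim (at_left (t j)) e0 = ?l"
    using assms(3) by (simp add: ltrace_def)
  then have 1: "?l * ?l - ?l' * ?r - cell_inner t j e1 e0 - (?l\<^sup>2 - ?r\<^sup>2) / 2 = 0"
    using e(3)[OF e(1)] cell_inner_deriv_self[OF e(1) assms(3), of d] by simp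
  have "?q = cell_inner t j (\<lambda>s. A * e0 s + 0) e1"
    using e(4)[OF e(2)] .
  also have "\<dots> = A * cell_inner t j e1 e0"
    by (simp add: cell_inner_def mult.assoc mult.commute[of "e0 _"])
  finally have 2: "2 / A * ?q = 2 * cell_inner t j e1 e0"
    using assms(2) by simp
  have "2 * cell_inner t j e1 e0 = 2 * (?l * ?l) - 2 * (?l' * ?r) - (?l\<^sup>2 - ?r\<^sup>2)"
    using 1 by (simp add: field_simps)
  then show ?thesis
    unfolding 2 trace_jump_def by (simp add: power2_eq_square algebra_simps)
qed

lemma sum_cell_inner:
  assumes "(\<lambda>s. u s * v s) integrable_on {0..t m}" "m \<le> n"
  shows "(\<Sum>j=1..m. cell_inner t j u v) = integral {0..t m} (\<lambda>s. u s * v s)"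
  using assms
proof (induction m)
  case (Suc m)
  have le: "0 \<le> t m" "t m \<le> t (Suc m)"
    using t_mono[of 0 m] t_mono[of m "Suc m"] t_0 Suc.prems by auto
  have "(\<lambda>s. u s * v s) integrable_on {0..t m}"
    by (rule integrable_on_subinterval[OF Suc.prems(1)]) (use le in auto)
  then have "(\<Sum>j=1..m. cell_inner t j u v) = integral {0..t m} (\<lambda>s. u s * v s)"
    using Suc by simp
  then show ?case
    using Henstock_Kurzweil_Integration.integral_combine[OF le Suc.prems(1)]
    by (simp add: cell_inner_def cell_def integral_open_interval_real)
qed (simp add: t_0)

text \<open>Stopping at an arbitrary mesh point is possible because the fractional integral looks
  only backwards; this gives stability at every step and not just at the final time.\<close>

lemma energy_identity:
  assumes sol: "ldg_solution \<alpha> A (\<lambda>_. 0) n t k d e0 e1" and "A \<noteq> 0" "0 < \<alpha>" "\<alpha> < 1"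
    and m: "m \<in> {1..n}"
  shows "(ltrace d t e0 m)\<^sup>2 = (ltrace d t e0 0)\<^sup>2 - (\<Sum>i=1..m. (trace_jump d t e0 (i - 1))\<^sup>2)
    + 2 / A * integral {0..t m} (\<lambda>s. frac_integral (1 - \<alpha>) e1 s * e1 s)"
proof -
  have e1: "e1 \<in> dg_space n t k"
    using sol by (auto simp: ldg_solution_def)
  have *: "(ltrace d t e0 l)\<^sup>2 = (ltrace d t e0 0)\<^sup>2 - (\<Sum>i=1..l. (trace_jump d t e0 (i - 1))\<^sup>2)
    + 2 / A * (\<Sum>j=1..l. cell_inner t j (frac_integral (1 - \<alpha>) e1) e1)" if "l \<le> n" for l
    using that
  proof (induction l)
    case (Suc l)
    then show ?case
      using cell_energy[OF sol assms(2), of "Suc l"] by (simp add: algebra_simps)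
  qed simp
  have "(\<Sum>j=1..m. cell_inner t j (frac_integral (1 - \<alpha>) e1) e1)
      = integral {0..t m} (\<lambda>s. frac_integral (1 - \<alpha>) e1 s * e1 s)"
    using frac_integral_form(1)[OF e1 m] assms(3,4) m by (intro sum_cell_inner) auto
  then show ?thesis
    using *[of m] m by simp
qed

lemma ltrace_le_initial:
  assumes sol: "ldg_solution \<alpha> A (\<lambda>_. 0) n t k d e0 e1" and "A < 0" "0 < \<alpha>" "\<alpha> < 1"
    and m: "m \<in> {1..n}"
  shows "\<bar>ltrace d t e0 m\<bar> \<le> \<bar>d\<bar>"
proof -
  have e1: "e1 \<in> dg_space n t k"
    using sol by (auto simp: ldg_solution_def)
  have "0 \<le> integral {0..t m} (\<lambda>s. frac_integral (1 - \<alpha>) e1 s * e1 s)"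
    using frac_integral_form(2)[OF e1 m] assms by simp
  then have "2 / A * integral {0..t m} (\<lambda>s. frac_integral (1 - \<alpha>) e1 s * e1 s) \<le> 0"
    using assms(2) by (intro mult_nonpos_nonneg) (simp_all add: divide_nonneg_neg)
  moreover have "0 \<le> (\<Sum>i=1..m. (trace_jump d t e0 (i - 1))\<^sup>2)"
    by (intro sum_nonneg) simp
  moreover have "ltrace d t e0 0 = d"
    by (simp add: ltrace_def)
  ultimately have "(ltrace d t e0 m)\<^sup>2 \<le> d\<^sup>2"
    using energy_identity[OF sol _ assms(3,4) m] assms(2) by simp
  then show ?thesis
    by (simp add: abs_le_square_iff)
qed

text \<open>With zero initial value the identity gives \<open>0 \<le> 2 / A * ?Q\<close>; since A <
  0 and the form is nonnegative, it is zero and \<open>e1\<close> vanishes off the mesh points. Its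
  fractional integral is then zero, and the second equation tested with \<open>e0\<close> leaves A
  times the squared norm of \<open>e0\<close> on the cell.\<close>

lemma ldg_solution_unique:
  assumes sol: "ldg_solution \<alpha> A (\<lambda>_. 0) n t k 0 e0 e1" and "A < 0" "0 < \<alpha>" "\<alpha> < 1"
    and j: "j \<in> {1..n}" and s: "s \<in> cell t j"
  shows "e0 s = 0"
proof -
  have V: "e0 \<in> dg_space n t k" "e1 \<in> dg_space n t k"
    using sol by (auto simp: ldg_solution_def)
  have n: "n \<in> {1..n}" using n_pos by simp
  let ?Q = "integral {0..t n} (\<lambda>s. frac_integral (1 - \<alpha>) e1 s * e1 s)"
  have "0 \<le> ?Q"
    using frac_integral_form(2)[OF V(2) n] assms by simp
  moreover have "0 \<le> 2 / A * ?Q"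
  proof -
    have "0 \<le> (\<Sum>i=1..n. (trace_jump 0 t e0 (i - 1))\<^sup>2)"
      by (intro sum_nonneg) simp
    then show ?thesis
      using energy_identity[OF sol _ assms(3,4) n] assms(2) zero_le_power2[of "ltrace 0 t e0 n"]
      by (simp add: ltrace_def)
  qed
  ultimately have Q: "?Q = 0"
    using assms(2) by (simp add: zero_le_divide_iff zero_le_mult_iff)
  have e1: "e1 u = 0" if "u \<in> {0..t n} - t ` {..n}" for u
    using frac_integral_form(3)[OF V(2) n _ _ Q that] assms(3,4) by simp
  have "frac_integral (1 - \<alpha>) e1 u = 0" if "u \<le> t n" for u
  proof -
    have "integral {0..u} (\<lambda>\<tau>. (u - \<tau>) powr (1 - \<alpha> - 1) * e1 \<tau>) = integral {0..u} (\<lambda>_. 0)"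
      by (rule integral_spike[OF negligible_mesh]) (use e1 that in auto)
    then show ?thesis
      by (simp add: frac_integral_def)
  qed
  then have "cell_inner t j (frac_integral (1 - \<alpha>) e1) e0 = integral (cell t j) (\<lambda>_. 0)"
    unfolding cell_inner_def using cell_subset[OF j order_refl] by (intro integral_cong) force
  moreover have "cell_inner t j (frac_integral (1 - \<alpha>) e1) e0 = cell_inner t j (\<lambda>s. A * e0 s + 0) e0"
    using ldg_solutionD(4)[OF sol j V(1)] .
  moreover have "cell_inner t j (\<lambda>s. A * e0 s + 0) e0 = A * cell_inner t j e0 e0"
    by (simp add: cell_inner_def mult.assoc)
  ultimately have zero: "cell_inner t j e0 e0 = 0"
    using assms(2) by simp
  obtain p where p: "\<And>s. s \<in> cell t j \<Longrightarrow> e0 s = poly p s"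
    using dg_spaceE[OF V(1) j] by blast
  have "cell_inner t j e0 e0 = integral (cell t j) (\<lambda>s. (poly p s)\<^sup>2)"
    unfolding cell_inner_def by (intro integral_cong) (simp add: p power2_eq_square)
  also have "\<dots> = integral {t (j - 1)..t j} (\<lambda>s. (poly p s)\<^sup>2)"
    by (simp add: cell_def integral_open_interval_real)
  finally have "integral {t (j - 1)..t j} (\<lambda>s. (poly p s)\<^sup>2) = 0"
    using zero by simp
  then have "\<forall>s\<in>{t (j - 1)..t j}. (poly p s)\<^sup>2 = 0"
    by (subst (asm) integral_eq_0_iff)
      (use cell_nonempty[OF j] in \<open>auto intro!: continuous_intros\<close>)
  then show ?thesis
    using s p[OF s] by (auto simp: cell_def)
qed

lemma ldg_solution_diff:
  assumes X: "ldg_solution \<alpha> A B n t k x0 X0 X1" and Y: "ldg_solution \<alpha> A B n t k y0 Y0 Y1"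
    and B: "B absolutely_integrable_on {0..T}" and \<alpha>: "\<alpha> < 1"
  shows "ldg_solution \<alpha> A (\<lambda>_. 0) n t k (y0 - x0) (\<lambda>s. Y0 s - X0 s) (\<lambda>s. Y1 s - X1 s)"
  using ldg_solution_linear[OF X Y B B \<alpha>, of "-1" 1] by simp

text \<open>
  By uniqueness any two errors are proportional, so that a single error with nonzero initial
  perturbation determines the constant.
\<close>

lemma Linf_stable_ldg:
  assumes B: "B absolutely_integrable_on {0..T}" and "A < 0" "0 < \<alpha>" "\<alpha> < 1"
  shows "Linf_stable \<alpha> A B n t k"
proof -
  let ?err = "\<lambda>d e0 e1. ldg_solution \<alpha> A (\<lambda>_. 0) n t k d e0 e1"
  have "\<exists>C. \<forall>d e0 e1. ?err d e0 e1 \<longrightarrow> (\<forall>j\<in>{1..n}. \<forall>s\<in>cell t j. \<bar>e0 s\<bar> \<le> C * \<bar>d\<bar>)"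
  \<comment> \<open>If every error starts from zero, uniqueness makes all of them vanish and the
    constant 0 serves; otherwise one error is the yardstick.\<close>
  proof (cases "\<exists>d e0 e1. ?err d e0 e1 \<and> d \<noteq> 0")
    case False
    then have "e0 s = 0" if "?err d e0 e1" "j \<in> {1..n}" "s \<in> cell t j" for d e0 e1 j s
    proof -
      have "d = 0"
        using False that(1) by blast
      then show ?thesis
        using ldg_solution_unique[OF _ assms(2-4) that(2,3)] that(1) by simp
    qed
    then show ?thesis
      by (intro exI[of _ 0]) simp
  next
    case True
    then obtain d e0 e1 where e: "?err d e0 e1" and d: "d \<noteq> 0"
      by blast
    then have "e0 \<in> dg_space n t k"
      by (simp add: ldg_solution_def)
    then obtain M where M: "\<And>j s. j \<in> {1..n} \<Longrightarrow> s \<in> cell t j \<Longrightarrow> \<bar>e0 s\<bar> \<le> M"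
      using dg_space_bounded by blast
    have "\<bar>f0 s\<bar> \<le> M / \<bar>d\<bar> * \<bar>c\<bar>" if f: "?err c f0 f1" and j: "j \<in> {1..n}" and s: "s \<in> cell t j" for c f0 f1 j s
    proof -
      \<comment> \<open>The coefficients are chosen so that the initial values \<open>d * c\<close>
        and \<open>c * d\<close> cancel.\<close>
      have "?err 0 (\<lambda>s. d * f0 s + (- c) * e0 s) (\<lambda>s. d * f1 s + (- c) * e1 s)"
        using ldg_solution_linear[OF f e _ _ assms(4), of d "- c"] by (simp add: mult.commute)
      then have "d * f0 s + (- c) * e0 s = 0"
        by (rule ldg_solution_unique[OF _ assms(2-4) j s])
      then have "f0 s = e0 s / d * c"
        using d by (simp add: field_simps)
      then have "\<bar>f0 s\<bar> = \<bar>e0 s\<bar> / \<bar>d\<bar> * \<bar>c\<bar>"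
        by (simp add: abs_mult)
      also have "\<dots> \<le> M / \<bar>d\<bar> * \<bar>c\<bar>"
        by (intro mult_right_mono divide_right_mono M[OF j s]) auto
      finally show ?thesis .
    qed
    then show ?thesis
      by blast
  qed
  then obtain C where C: "\<And>d e0 e1 j s. ?err d e0 e1 \<Longrightarrow> j \<in> {1..n} \<Longrightarrow> s \<in> cell t j \<Longrightarrow> \<bar>e0 s\<bar> \<le> C * \<bar>d\<bar>"
    by blast
  show ?thesis
    unfolding Linf_stable_def
  proof (intro exI[of _ C] allI impI conjI ballI)
    fix x0 y0 X0 X1 Y0 Y1 j
    assume XY: "ldg_solution \<alpha> A B n t k x0 X0 X1" "ldg_solution \<alpha> A B n t k y0 Y0 Y1"
      and j: "j \<in> {1..n}"
    note e = ldg_solution_diff[OF XY B assms(4)]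
    show "\<bar>ltrace (y0 - x0) t (\<lambda>s. Y0 s - X0 s) j\<bar> \<le> \<bar>y0 - x0\<bar>"
      by (rule ltrace_le_initial[OF e assms(2-4) j])
    show "\<bar>Y0 s - X0 s\<bar> \<le> C * \<bar>y0 - x0\<bar>" if "s \<in> cell t j" for s
      by (rule C[OF e j that])
  qed
qed

end

theorem theorem2p1:
  fixes \<alpha> A T x0 y0 :: real
    and B X0 X1 Y0 Y1 e0 e1 :: "real \<Rightarrow> real"
    and n k :: nat and t :: "nat \<Rightarrow> real"
  assumes "0 < \<alpha>" and "\<alpha> < 1" and "A < 0"
    and "mesh T n t"
    and "B absolutely_integrable_on {0..T}"
    and "caputo_ivp_well_posed \<alpha> A B T x0"
    and "ldg_solution \<alpha> A B n t k x0 X0 X1"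
    and "ldg_solution \<alpha> A B n t k y0 Y0 Y1"
    and "e0 = (\<lambda>s. Y0 s - X0 s)" and "e1 = (\<lambda>s. Y1 s - X1 s)"
  shows "Linf_stable \<alpha> A B n t k \<and>
    (ltrace (y0 - x0) t e0 n)\<^sup>2 =
      (ltrace (y0 - x0) t e0 0)\<^sup>2
      - (\<Sum>i=1..n. (trace_jump (y0 - x0) t e0 (i - 1))\<^sup>2)
      + 2 / A * cos ((\<alpha> - 1) * pi / 2) * (neg_sobolev_norm \<alpha> (t n) e1)\<^sup>2"
proof
  interpret dg_mesh T n t
    by unfold_locales fact
  show "Linf_stable \<alpha> A B n t k"
    using Linf_stable_ldg assms by blast
  have sol: "ldg_solution \<alpha> A (\<lambda>_. 0) n t k (y0 - x0) e0 e1"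
    unfolding assms(9,10) using ldg_solution_diff assms by blast
  then have e1: "e1 \<in> dg_space n t k"
    by (simp add: ldg_solution_def)
  have n: "n \<in> {1..n}" using n_pos by simp
  \<comment> \<open>This licenses replacing the integral in the energy identity by the norm.\<close>
  have "0 \<le> integral {0..t n} (\<lambda>s. frac_integral (1 - \<alpha>) e1 s * e1 s)"
    using frac_integral_form(2)[OF e1 n] assms by simp
  from neg_sobolev_norm_square[OF assms(1,2) this] energy_identity[OF sol _ assms(1,2) n]
  show "(ltrace (y0 - x0) t e0 n)\<^sup>2 =
      (ltrace (y0 - x0) t e0 0)\<^sup>2
      - (\<Sum>i=1..n. (trace_jump (y0 - x0) t e0 (i - 1))\<^sup>2)
      + 2 / A * cos ((\<alpha> - 1) * pi / 2) * (neg_sobolev_norm \<alpha> (t n) e1)\<^sup>2"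
    using assms(3) by (simp only: mult.assoc)
qed

end
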